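(* Consider the stochastic optimization problem $\min_{x\in\mathbb{R}^n} f(x)$, $f(x):=\mathsf{E}[F(x,\xi)]$, and let $\{x_k\}$ be generated by the cyclic regularized stochastic quasi-Newton algorithm described in the context. Assume: (A1) $F(\cdot,\xi)$ is convex for every realization of $\xi$; $f$ is continuously differentiable on $\mathbb{R}^n$ with gradient Lipschitz continuous with parameter $L>0$; the optimal solution set of the problem is nonempty. (A2) The random variables $\xi_k$, $k\ge 0$, are i.i.d.; $\nabla F(x,\xi)$ is an unbiased estimator of $\nabla f(x)$, i.e. $\mathsf{E}[\nabla F(x,\xi)]=\nabla f(x)$; and there is $\nu>0$ such that $\mathsf{E}[\|\nabla F(x,\xi)-\nabla f(x)\|^2]\le \nu^2$ for any $x\in\mathbb{R}^n$. (A4) The sequences $\{\gamma_k\},\{\mu_k\},\{\delta_k\}$ (positive, as required by the algorithm) satisfy: (a) $\lim_{k\to\infty}\frac{\gamma_k}{\mu_k^3\delta_k}=0$; (b) $\delta_k\mu_{k-1}\le 1$ for $k\ge 1$; (c) $\mu_{k+1}=\mu_k$ if $k$ is even and $\mu_{k+1}<\mu_k$ if $k$ is odd; (d) there exist $0<\alpha<1$ and $K_1\ge 0$ such that $\frac{\gamma_{k-1}}{\mu_{k-1}^3\delta_{k-1}}\le\frac{\gamma_k}{\mu_k^3\delta_k}(1+\alpha\gamma_k\delta_k\mu_k)$ for $k\ge K_1$; (e) there exist a scalar $\mathcal{B}>0$ and $K_2\ge 0$ such that $\delta_k\mu_k^4\le\mathcal{B}\gamma_k$ for $k\ge K_2$.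 Let $f^*$ be the optimal value and $x^*$ any optimal solution of the problem. Then there exists some $K\ge 0$ such that $$\mathsf{E}[f(x_{k+1})]-f^*\le\theta\,\frac{\gamma_k}{\mu_k^3\delta_k}\qquad\text{for any }k\ge K,$$ where $$\theta=\max\left\{\frac{\mu_K^3\delta_K e_{K+1}}{\gamma_K},\ \frac{0.5\,\mathcal{B}\|x^*\|^2+2(L+\mu_0)\frac{\nu^2}{\rho^2}}{1-\alpha}\right\},\qquad e_{K+1}:=\mathsf{E}[f_{K+1}(x_{K+1})]-f^*,$$ and $f_k(x):=f(x)+\frac{\mu_k}{2}\|x\|^2$.
   Context: Setting: $(\Omega,\mathcal{F},\mathbb{P})$ is a probability space, $\xi:\Omega\to\mathbb{R}^d$ is a random vector, $F:\mathbb{R}^n\times\mathbb{R}^d\to\mathbb{R}$ is a function, and $\nabla F(x,\xi)$ denotes its gradient with respect to $x$. $\|\cdot\|$ is the Euclidean norm, $\mathbf{I}$ the identity matrix, and $A\succeq C$ means $A-C$ is positive semidefinite. Algorithm (CR-SQN): given an initial (possibly random) point $x_0\in\mathbb{R}^n$, samples $\xi_0,\xi_1,\dots$ of $\xi$, stepsizes $\gamma_k>0$, regularization parameters $\delta_k>0$ and $\mu_k>0$, a constant $0<\rho<1$, and a symmetric matrix $B_0\succeq\rho\mu_0\mathbf{I}$, for $k\ge 0$ set $$x_{k+1}:=x_k-\gamma_k\left(B_k^{-1}+\delta_k\mathbf{I}\right)\left(\nabla F(x_k,\xi_k)+\mu_kx_k\right).$$ The sequence $\mu_k$ satisfies $\mu_{k+1}=\mu_k$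 for even $k$ and $\mu_{k+1}<\mu_k$ for odd $k$. The matrices are updated by $$B_{k+1}:=\begin{cases} B_k-\dfrac{B_ks_ks_k^TB_k}{s_k^TB_ks_k}+\dfrac{y_k^B(y_k^B)^T}{s_k^Ty_k^B}+\rho\mu_k\mathbf{I}, & k\text{ even},\\ B_k, & k\text{ odd},\end{cases}$$ where for even $k$: $s_k:=x_{k+1}-x_k$ and $y_k^B:=\nabla F(x_{k+1},\xi_k)-\nabla F(x_k,\xi_k)+(1-\rho)\mu_ks_k$. Standing assumption: when $k$ is even, $\mu_k<\mu_{k-1}$ is chosen such that $\nabla F(x_k,\xi_k)+\mu_kx_k\ne 0$. *)

theory Defs
  imports "HOL-Probability.Probability"
begin

definition grad :: "('a::real_inner \<Rightarrow> real) \<Rightarrow> 'a \<Rightarrow> 'a" where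
  "grad g x = (THE D. GDERIV g x :> D)"

lemma grad_eqI:
  assumes "GDERIV g x :> D"
  shows "grad g x = D"
  unfolding grad_def
proof (rule the_equality)
  show "GDERIV g x :> D" by fact
next
  fix D' assume "GDERIV g x :> D'"
  then have "(\<lambda>h. inner h D') = (\<lambda>h. inner h D)"
    using assms has_derivative_unique unfolding gderiv_def by blast
  then have "inner (D' - D) D' = inner (D' - D) D" by metis
  then have "inner (D' - D) (D' - D) = 0" by (simp add: inner_diff_right)
  then show "D' = D" by simp
qed

lemma GDERIV_grad:
  fixes g :: "'a::euclidean_space \<Rightarrow> real"
  assumes "g differentiable (at x)"
  shows "GDERIV g x :> grad g x"
proof -
  obtain g' where g': "(g has_derivative g') (at x)"
    using assms by (auto simp: differentiable_def)
  interpret bounded_linear g' using g' by (rule has_derivative_bounded_linear)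
  have "g' h = inner h (\<Sum>b\<in>Basis. g' b *\<^sub>R b)" for h
  proof -
    have "g' h = g' (\<Sum>b\<in>Basis. inner h b *\<^sub>R b)" by (simp add: euclidean_representation)
    also have "\<dots> = (\<Sum>b\<in>Basis. inner h b * g' b)" by (simp add: sum scaleR)
    also have "\<dots> = inner h (\<Sum>b\<in>Basis. g' b *\<^sub>R b)"
      by (simp add: inner_sum_right mult.commute)
    finally show ?thesis .
  qed
  then have "GDERIV g x :> (\<Sum>b\<in>Basis. g' b *\<^sub>R b)"
    using g' unfolding gderiv_def by (metis (no_types, lifting) ext)
  then show ?thesis using grad_eqI by metis
qed

definition outer :: "real^'n \<Rightarrow> real^'n \<Rightarrow> real^'n^'n" where
  "outer u v = (\<chi> i j. u $ i * v $ j)"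

definition psd :: "real^'n^'n \<Rightarrow> bool" where
  "psd A \<longleftrightarrow> transpose A = A \<and> (\<forall>v. 0 \<le> inner v (A *v v))"

text \<open>
  The expectation of a real random variable as an extended real, namely the expectation of its
  positive part minus that of its negative part. Unlike the Bochner integral, which is 0 for
  non-integrable functions, it takes the value \<open>\<infinity>\<close> for a measurable function that is bounded
  below and not integrable.
\<close>

definition expect_ext :: "'w measure \<Rightarrow> ('w \<Rightarrow> real) \<Rightarrow> ereal" where
  "expect_ext M X =
     enn2ereal (\<integral>\<^sup>+w. ennreal (X w) \<partial>M) - enn2ereal (\<integral>\<^sup>+w. ennreal (- X w) \<partial>M)"

lemma expect_ext_integrable:
  assumes "integrable M X"
  shows "expect_ext M X = ereal (\<integral>w. X w \<partial>M)"
proof -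
  have fin: "(\<integral>\<^sup>+w. ennreal (X w) \<partial>M) < \<infinity>" "(\<integral>\<^sup>+w. ennreal (- X w) \<partial>M) < \<infinity>"
    using assms by (auto simp: real_integrable_def less_top)
  have e: "enn2ereal a = ereal (enn2real a)" if "a < \<infinity>" for a :: ennreal
    using that by (cases a) (auto simp: enn2ereal_ennreal)
  show ?thesis
    unfolding expect_ext_def e[OF fin(1)] e[OF fin(2)] real_lebesgue_integral_def[OF assms]
    by simp
qed

text \<open>
  The matrix update for even indices, where \<open>s\<close> is the step, \<open>y\<close> the (regularized) change of the
  sampled gradient along it, and \<open>c\<close> the coefficient of the added multiple of the identity.
\<close>

definition bfgs_update :: "real^'n^'n \<Rightarrow> real^'n \<Rightarrow> real^'n \<Rightarrow> real \<Rightarrow> real^'n^'n" where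
  "bfgs_update B s y c =
     B - (1 / inner s (B *v s)) *\<^sub>R (B ** outer s s ** B)
       + (1 / inner s y) *\<^sub>R outer y y + c *\<^sub>R mat 1"

text \<open>
  The processes \<open>x\<close> (started at the random point \<open>x 0\<close>) and \<open>B\<close> are generated, on every outcome in
  \<open>\<Omega>\<close>, by the cyclic regularized stochastic quasi-Newton method with sampled gradients
  \<open>G (x k w) (xi k w)\<close>.
\<close>

definition cr_sqn ::
  "'w set \<Rightarrow> (real^'n \<Rightarrow> 'z \<Rightarrow> real^'n) \<Rightarrow> (nat \<Rightarrow> 'w \<Rightarrow> 'z) \<Rightarrow>
   (nat \<Rightarrow> real) \<Rightarrow> (nat \<Rightarrow> real) \<Rightarrow> (nat \<Rightarrow> real) \<Rightarrow> real \<Rightarrow> real^'n^'n \<Rightarrow>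
   (nat \<Rightarrow> 'w \<Rightarrow> real^'n) \<Rightarrow> (nat \<Rightarrow> 'w \<Rightarrow> real^'n^'n) \<Rightarrow> bool" where
  "cr_sqn \<Omega> G xi \<gamma> \<delta> \<mu> \<rho> B0 x B \<longleftrightarrow>
     (\<forall>w\<in>\<Omega>. B 0 w = B0) \<and>
     (\<forall>w\<in>\<Omega>. \<forall>k. x (Suc k) w =
        x k w - \<gamma> k *\<^sub>R ((matrix_inv (B k w) + \<delta> k *\<^sub>R mat 1)
                          *v (G (x k w) (xi k w) + \<mu> k *\<^sub>R x k w))) \<and>
     (\<forall>w\<in>\<Omega>. \<forall>k. B (Suc k) w =
        (if even k then
           (let s = x (Suc k) w - x k w;
                y = G (x (Suc k) w) (xi k w) - G (x k w) (xi k w) + ((1 - \<rho>) * \<mu> k) *\<^sub>R s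
            in bfgs_update (B k w) s y (\<rho> * \<mu> k))
         else B k w))"

definition regularized :: "('a::real_normed_vector \<Rightarrow> real) \<Rightarrow> real \<Rightarrow> 'a \<Rightarrow> real" where
  "regularized f m x = f x + m / 2 * (norm x)\<^sup>2"

end

theory Submission
  imports Defs
begin

text \<open>
  Pointwise, every \<open>B\<^sub>k\<close> dominates \<open>\<rho> \<mu>\<^sub>k I\<close>, so \<open>H\<^sub>k = B\<^sub>k\<^sup>-\<^sup>1 + \<delta>\<^sub>k I\<close> lies between \<open>\<delta>\<^sub>k I\<close> and
  \<open>2 / (\<rho> \<mu>\<^sub>k) I\<close>. As \<open>(x\<^sub>k, B\<^sub>k)\<close> is independent of \<open>\<xi>\<^sub>k\<close>, one may average over \<open>\<xi>\<^sub>k\<close> with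
  \<open>(x\<^sub>k, B\<^sub>k)\<close> frozen; the descent lemma for \<open>f\<^sub>k\<close> and the gradient domination given by its strong
  convexity then yield \<open>e\<^sub>k\<^sub>+\<^sub>1 \<le> (1 - t\<^sub>k) e\<^sub>k + C t\<^sub>k r\<^sub>k\<close>, where \<open>t\<^sub>k = \<gamma>\<^sub>k \<delta>\<^sub>k \<mu>\<^sub>k\<close> and
  \<open>r\<^sub>k = \<gamma>\<^sub>k / (\<mu>\<^sub>k\<^sup>3 \<delta>\<^sub>k)\<close>. Condition (d) of (A4) propagates the bound \<open>e\<^sub>k\<^sub>+\<^sub>1 \<le> \<theta> r\<^sub>k\<close> along
  this recursion. All expected gaps are kept as extended nonnegative integrals of
  \<open>f\<^sub>k(x\<^sub>k) - f\<^sup>* \<ge> 0\<close>, so integrability of the iterates is never needed; if \<open>e\<^sub>K\<^sub>+\<^sub>1\<close> is infinite,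
  then so is \<open>\<theta>\<close>.
\<close>

section \<open>Gradients of smooth convex functions\<close>

text \<open>Restriction to a line turns the tangent inequality, the descent estimate and the limits
  of difference quotients below into one-variable calculus.\<close>

lemma GDERIV_line:
  fixes f :: "'a::real_inner \<Rightarrow> real"
  assumes "GDERIV f (u + t *\<^sub>R d) :> D"
  shows "((\<lambda>t. f (u + t *\<^sub>R d)) has_real_derivative inner D d) (at t within S)"
proof -
  have "((\<lambda>t. u + t *\<^sub>R d) has_derivative (\<lambda>h. h *\<^sub>R d)) (at t within S)"
    by (auto intro!: derivative_eq_intros)
  from has_derivative_compose[OF this assms[unfolded gderiv_def]]
  show ?thesis
    by (simp add: has_field_derivative_def inner_commute mult_commute_abs)
qed

text \<open>On the line from \<open>u\<close> to \<open>v\<close> a convex function lies above its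
  tangent at 0; the claim is that bound read off at 1.\<close>

lemma convex_on_gradient_ineq:
  fixes f :: "'a::real_inner \<Rightarrow> real"
  assumes "convex_on UNIV f" and "GDERIV f u :> D"
  shows "f u + inner D (v - u) \<le> f v"
proof -
  let ?p = "\<lambda>t. f (u + t *\<^sub>R (v - u))"
  have "convex_on UNIV ?p"
  proof (rule convex_onI)
    fix t a b :: real assume t: "0 < t" "t < 1"
    have "u + ((1 - t) *\<^sub>R a + t *\<^sub>R b) *\<^sub>R (v - u)
        = (1 - t) *\<^sub>R (u + a *\<^sub>R (v - u)) + t *\<^sub>R (u + b *\<^sub>R (v - u))"
      by (simp add: algebra_simps)
    then show "?p ((1 - t) *\<^sub>R a + t *\<^sub>R b) \<le> (1 - t) * ?p a + t * ?p b"
      using convex_onD[OF assms(1), of t "u + a *\<^sub>R (v - u)" "u + b *\<^sub>R (v - u)"] t by simp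
  qed simp
  moreover have "(?p has_real_derivative inner D (v - u)) (at 0 within UNIV)"
    by (rule GDERIV_line) (simp add: assms)
  ultimately have "?p 1 - ?p 0 \<ge> inner D (v - u) * (1 - 0)"
    by (intro convex_on_imp_above_tangent) auto
  then show ?thesis by simp
qed

text \<open>Adding the tangent inequalities at \<open>u\<close> and at \<open>v\<close> cancels the
  function values.\<close>

lemma convex_on_gradient_mono:
  fixes f :: "'a::real_inner \<Rightarrow> real"
  assumes "convex_on UNIV f" "GDERIV f u :> D" "GDERIV f v :> E"
  shows "0 \<le> inner (D - E) (u - v)"
  using convex_on_gradient_ineq[OF assms(1,2), of v] convex_on_gradient_ineq[OF assms(1,3), of u]
  by (simp add: inner_diff_left inner_diff_right)

text \<open>Along the segment, \<open>f\<close> minus its quadratic majorant has nonpositive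
  derivative on [0,1]: at parameter t the gradient has moved by at most L t |d|.\<close>

lemma descent_lemma:
  fixes f :: "'a::real_inner \<Rightarrow> real"
  assumes D: "\<And>y. GDERIV f y :> D y" and L: "L-lipschitz_on UNIV D"
  shows "f (u + d) \<le> f u + inner (D u) d + L / 2 * (norm d)\<^sup>2"
proof -
  let ?p = "\<lambda>t. f (u + t *\<^sub>R d) - t * inner (D u) d - L / 2 * t\<^sup>2 * (norm d)\<^sup>2"
  have "?p 1 \<le> ?p 0"
  proof (rule DERIV_nonpos_imp_nonincreasing[of 0 1 ?p])
    fix t :: real assume t: "0 \<le> t" "t \<le> 1"
    let ?d = "inner (D (u + t *\<^sub>R d)) d - inner (D u) d - L * t * (norm d)\<^sup>2"
    have "(?p has_real_derivative ?d) (at t)"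
      by (auto intro!: derivative_eq_intros GDERIV_line D)
    moreover have "inner (D (u + t *\<^sub>R d) - D u) d \<le> L * t * (norm d)\<^sup>2"
    proof -
      have "inner (D (u + t *\<^sub>R d) - D u) d \<le> norm (D (u + t *\<^sub>R d) - D u) * norm d"
        by (rule norm_cauchy_schwarz)
      also have "\<dots> \<le> (L * (t * norm d)) * norm d"
        using lipschitz_onD[OF L, of "u + t *\<^sub>R d" u] t
        by (intro mult_right_mono) (auto simp: dist_norm)
      finally show ?thesis by (simp add: power2_eq_square mult_ac)
    qed
    ultimately show "\<exists>y. (?p has_real_derivative y) (at t) \<and> y \<le> 0"
      by (intro exI[of _ ?d]) (simp add: inner_diff_left)
  qed simp
  then show ?thesis by simp
qed

lemma norm_add_squared:
  fixes u d :: "'a::real_inner"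
  shows "(norm (u + d))\<^sup>2 = (norm u)\<^sup>2 + 2 * inner u d + (norm d)\<^sup>2"
  by (simp add: power2_norm_eq_inner inner_add_left inner_add_right inner_commute)

lemma regularized_descent:
  fixes f :: "'a::real_inner \<Rightarrow> real"
  assumes "\<And>y. GDERIV f y :> D y" and "L-lipschitz_on UNIV D"
  shows "regularized f m (u + d)
           \<le> regularized f m u + inner (D u + m *\<^sub>R u) d + (L + m) / 2 * (norm d)\<^sup>2"
  using descent_lemma[OF assms, of u d]
  unfolding regularized_def norm_add_squared
  by (simp add: inner_add_left field_simps)

text \<open>Strong convexity bounds the regularized function from below by a quadratic in y - u;
  completing the square gives a Polyak-Lojasiewicz inequality. The comparison point \<open>y\<close>
  is arbitrary, so that it can later be a minimizer of \<open>f\<close> itself.\<close>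

lemma regularized_gradient_dominated:
  fixes f :: "'a::real_inner \<Rightarrow> real"
  assumes f: "convex_on UNIV f" "GDERIV f u :> D" and m: "0 < m"
  shows "2 * m * (regularized f m u - regularized f m y) \<le> (norm (D + m *\<^sub>R u))\<^sup>2"
proof -
  define e where "e = y - u"
  let ?p = "D + m *\<^sub>R u"
  have "f u + inner D e \<le> f y" unfolding e_def by (rule convex_on_gradient_ineq[OF f])
  moreover have "(norm y)\<^sup>2 = (norm u)\<^sup>2 + 2 * inner u e + (norm e)\<^sup>2"
    using norm_add_squared[of u e] by (simp add: e_def)
  ultimately have "regularized f m u + inner ?p e + m / 2 * (norm e)\<^sup>2 \<le> regularized f m y"
    by (simp add: regularized_def inner_add_left field_simps)
  moreover have "0 \<le> (norm (?p + m *\<^sub>R e))\<^sup>2" by simp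
  then have "0 \<le> (norm ?p)\<^sup>2 + 2 * m * (inner ?p e + m / 2 * (norm e)\<^sup>2)"
    unfolding norm_add_squared by (simp add: power_mult_distrib power2_eq_square algebra_simps)
  moreover have "2 * m * (inner ?p e + m / 2 * (norm e)\<^sup>2)
      \<le> 2 * m * (regularized f m y - regularized f m u)"
    using m calculation(1) by (intro mult_left_mono) auto
  ultimately show ?thesis by (simp add: algebra_simps)
qed

section \<open>Positive definiteness of the BFGS update\<close>

lemma inner_outer_mult: "inner v (outer a b *v w) = inner v a * inner b w"
  unfolding inner_vec_def matrix_vector_mult_def outer_def sum_product
  by (simp add: sum_distrib_left mult_ac)

lemma inner_matrix_symmetric:
  fixes A :: "real^'n^'n"
  assumes "transpose A = A"
  shows "inner v (A *v w) = inner (A *v v) w"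
  by (metis assms dot_lmul_matrix transpose_matrix_vector)

text \<open>The form at v - t w is a nonnegative polynomial in t of degree at most two; if its
  leading coefficient \<open>?a\<close> is positive, its value at the minimizer
  \<open>?b / ?a\<close> gives the claim.\<close>

lemma psd_cauchy_schwarz:
  fixes A :: "real^'n^'n"
  assumes sym: "transpose A = A" and nn: "\<And>v. 0 \<le> inner v (A *v v)"
  shows "(inner v (A *v w))\<^sup>2 \<le> inner v (A *v v) * inner w (A *v w)"
proof -
  let ?a = "inner w (A *v w)" and ?b = "inner v (A *v w)" and ?c = "inner v (A *v v)"
  have b: "inner w (A *v v) = ?b"
    by (metis inner_matrix_symmetric[OF sym] inner_commute)
  have q: "0 \<le> ?c - 2 * t * ?b + t\<^sup>2 * ?a" for t
    using nn[of "v - t *\<^sub>R w"] b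
    by (simp add: matrix_vector_mult_diff_distrib matrix_vector_mult_scaleR inner_diff_left
        inner_diff_right power2_eq_square algebra_simps)
  show ?thesis
  proof (cases "?a = 0")
    case True
    have "?b = 0"
    proof (rule ccontr)
      assume "?b \<noteq> 0"
      \<comment> \<open>With vanishing leading coefficient the polynomial is affine in t, and this t
        gives it the value -1.\<close>
      then show False using q[of "(?c + 1) / (2 * ?b)"] True by simp
    qed
    then show ?thesis using True by simp
  next
    case False
    then have a: "0 < ?a" using nn[of w] by simp
    have "0 \<le> (?c - 2 * (?b / ?a) * ?b + (?b / ?a)\<^sup>2 * ?a) * ?a"
      using q[of "?b / ?a"] a by simp
    also have "\<dots> = ?c * ?a - ?b\<^sup>2" using a by (simp add: field_simps power2_eq_square)
    finally show ?thesis by simp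
  qed
qed

lemma transpose_add: "transpose (A + C) = transpose A + transpose C"
  by (simp add: transpose_def vec_eq_iff)

lemma transpose_diff: "transpose (A - C) = transpose A - transpose (C :: real^'n^'m)"
  by (simp add: transpose_def vec_eq_iff)

lemma transpose_scaleR: "transpose (c *\<^sub>R A) = c *\<^sub>R transpose A"
  by (simp add: transpose_def vec_eq_iff)

lemma transpose_outer: "transpose (outer u u) = outer u u"
  by (simp add: transpose_def outer_def vec_eq_iff mult.commute)

lemma psd_diff_mat_iff:
  fixes A :: "real^'n^'n"
  shows "psd (A - c *\<^sub>R mat 1) \<longleftrightarrow> transpose A = A \<and> (\<forall>v. c * (norm v)\<^sup>2 \<le> inner v (A *v v))"
  by (simp add: psd_def transpose_diff transpose_scaleR transpose_mat matrix_vector_mult_diff_rdistrib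
      scaleR_matrix_vector_assoc[symmetric] inner_diff_right power2_norm_eq_inner)

text \<open>
  For \<open>s = 0\<close> both rank-one terms vanish because \<open>1 / 0 = 0\<close>, so the bound also covers a zero step.
\<close>

lemma psd_bfgs_update:
  fixes A :: "real^'n^'n"
  assumes sym: "transpose A = A" and nn: "\<And>v. 0 \<le> inner v (A *v v)" and sy: "0 \<le> inner s y"
  shows "psd (bfgs_update A s y c - c *\<^sub>R mat 1)"
proof -
  have "transpose (A ** outer s s ** A) = A ** outer s s ** A"
    by (simp add: matrix_transpose_mul sym transpose_outer matrix_mul_assoc)
  then have "transpose (bfgs_update A s y c) = bfgs_update A s y c"
    by (simp add: bfgs_update_def transpose_add transpose_diff transpose_scaleR transpose_outer
        transpose_mat sym)
  moreover have "c * (norm v)\<^sup>2 \<le> inner v (bfgs_update A s y c *v v)" for v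
  proof -
    have "inner v ((A ** outer s s ** A) *v v) = inner v (A *v (outer s s *v (A *v v)))"
      by (simp only: matrix_vector_mul_assoc matrix_mul_assoc)
    also have "\<dots> = inner (A *v v) (outer s s *v (A *v v))"
      by (rule inner_matrix_symmetric[OF sym])
    also have "\<dots> = inner (A *v v) s * inner (A *v v) s"
      by (simp only: inner_outer_mult inner_commute[of s])
    also have "\<dots> = (inner v (A *v s))\<^sup>2"
      by (simp only: inner_matrix_symmetric[OF sym] power2_eq_square)
    finally have "inner v ((A ** outer s s ** A) *v v) = (inner v (A *v s))\<^sup>2" .
    then have "inner v (bfgs_update A s y c *v v) = inner v (A *v v)
        - (inner v (A *v s))\<^sup>2 / inner s (A *v s) + (inner v y)\<^sup>2 / inner s y + c * (norm v)\<^sup>2"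
      by (simp add: bfgs_update_def matrix_vector_mult_add_rdistrib matrix_vector_mult_diff_rdistrib
          scaleR_matrix_vector_assoc[symmetric] inner_add_right inner_diff_right inner_outer_mult
          inner_commute[of y] power2_norm_eq_inner power2_eq_square[of "inner v y"])
    \<comment> \<open>The subtracted term removes at most the whole form of \<open>A\<close>, by
      Cauchy-Schwarz for that form. What survives for certain is the added multiple of the
      identity.\<close>
    moreover have "(inner v (A *v s))\<^sup>2 / inner s (A *v s) \<le> inner v (A *v v)"
    proof (cases "inner s (A *v s) = 0")
      case False
      then have "0 < inner s (A *v s)" using nn[of s] by simp
      then show ?thesis using psd_cauchy_schwarz[OF sym nn, of v s] by (simp add: field_simps)
    qed (simp add: nn)
    moreover have "0 \<le> (inner v y)\<^sup>2 / inner s y" using sy by simp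
    ultimately show ?thesis by simp
  qed
  ultimately show ?thesis by (simp add: psd_diff_mat_iff)
qed

lemma coercive_matrix_invertible:
  fixes A :: "real^'n^'n"
  assumes "0 < c" and A: "\<And>v. c * (norm v)\<^sup>2 \<le> inner v (A *v v)"
  shows "invertible A"
proof -
  have "v = 0" if "A *v v = 0" for v
    using A[of v] that \<open>0 < c\<close> by (simp add: mult_le_0_iff)
  then show ?thesis
    by (simp add: invertible_left_inverse matrix_left_invertible_ker)
qed

lemma matrix_mult_matrix_inv:
  assumes "invertible A"
  shows "A ** matrix_inv A = mat 1"
  using someI_ex[OF assms[unfolded invertible_def]] by (simp add: matrix_inv_def)

text \<open>Put v = A u. Coercivity at u reads c |u|^2 \<le> <v, u>, which gives the sign at once
  and the norm bound through Cauchy-Schwarz.\<close>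

lemma coercive_matrix_inv:
  fixes A :: "real^'n^'n"
  assumes c: "0 < c" and A: "\<And>v. c * (norm v)\<^sup>2 \<le> inner v (A *v v)"
  shows "0 \<le> inner v (matrix_inv A *v v)" and "norm (matrix_inv A *v v) \<le> norm v / c"
proof -
  define u where "u = matrix_inv A *v v"
  have v: "v = A *v u"
    unfolding u_def matrix_vector_mul_assoc matrix_mult_matrix_inv[OF coercive_matrix_invertible[OF assms]]
    by simp
  have "inner v u = inner u (A *v u)" by (simp add: v inner_commute)
  then have *: "c * (norm u)\<^sup>2 \<le> inner v u" using A[of u] by simp
  then show "0 \<le> inner v (matrix_inv A *v v)"
    unfolding u_def[symmetric] using c by (meson order_trans mult_nonneg_nonneg less_imp_le zero_le_power2)
  have "c * norm u * norm u \<le> norm v * norm u"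
    using * norm_cauchy_schwarz[of v u] by (simp add: power2_eq_square)
  then have "c * norm u \<le> norm v"
    by (cases "u = 0") (auto simp: mult_le_cancel_right)
  then show "norm (matrix_inv A *v v) \<le> norm v / c"
    unfolding u_def[symmetric] using c by (simp add: field_simps)
qed

lemma
  fixes A :: "real^'n^'n"
  assumes c: "0 < c" and A: "\<And>v. c * (norm v)\<^sup>2 \<le> inner v (A *v v)" and \<delta>: "0 \<le> \<delta>"
  shows shifted_inv_coercive: "\<delta> * (norm v)\<^sup>2 \<le> inner v ((matrix_inv A + \<delta> *\<^sub>R mat 1) *v v)"
    and shifted_inv_bounded: "norm ((matrix_inv A + \<delta> *\<^sub>R mat 1) *v v) \<le> (1 / c + \<delta>) * norm v"
proof -
  have e: "(matrix_inv A + \<delta> *\<^sub>R mat 1) *v v = matrix_inv A *v v + \<delta> *\<^sub>R v"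
    by (simp add: matrix_vector_mult_add_rdistrib scaleR_matrix_vector_assoc[symmetric])
  show "\<delta> * (norm v)\<^sup>2 \<le> inner v ((matrix_inv A + \<delta> *\<^sub>R mat 1) *v v)"
    unfolding e using coercive_matrix_inv(1)[OF c A, of v]
    by (simp add: inner_add_right power2_norm_eq_inner)
  have "norm (matrix_inv A *v v + \<delta> *\<^sub>R v) \<le> norm (matrix_inv A *v v) + \<delta> * norm v"
    using norm_triangle_ineq[of "matrix_inv A *v v" "\<delta> *\<^sub>R v"] \<delta> by simp
  then show "norm ((matrix_inv A + \<delta> *\<^sub>R mat 1) *v v) \<le> (1 / c + \<delta>) * norm v"
    unfolding e using coercive_matrix_inv(2)[OF c A, of v] by (simp add: algebra_simps)
qed

section \<open>Measurability\<close>

lemma borel_measurable_vec_lambda [measurable (raw)]: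
  fixes f :: "'i::finite \<Rightarrow> 'a \<Rightarrow> 'b::euclidean_space"
  assumes "\<And>i. f i \<in> borel_measurable M"
  shows "(\<lambda>w. \<chi> i. f i w) \<in> borel_measurable M"
proof (rule borel_measurable_euclidean_space[THEN iffD2], rule ballI)
  fix b :: "'b^'i" assume "b \<in> Basis"
  then obtain i v where "b = axis i v" unfolding Basis_vec_def by blast
  then show "(\<lambda>w. (\<chi> i. f i w) \<bullet> b) \<in> borel_measurable M"
    using assms[of i] by (simp add: inner_axis)
qed

lemma borel_measurable_vec_nth [measurable (raw)]:
  fixes f :: "'a \<Rightarrow> ('b::euclidean_space)^'i"
  assumes "f \<in> borel_measurable M"
  shows "(\<lambda>w. f w $ i) \<in> borel_measurable M"
proof -
  have "continuous_on UNIV (\<lambda>v :: 'b^'i. v $ i)" by (intro continuous_intros)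
  from borel_measurable_continuous_on[OF this assms] show ?thesis .
qed

lemma borel_measurable_matrix_vector_mult [measurable (raw)]:
  fixes A :: "'a \<Rightarrow> real^'n^'m"
  assumes "A \<in> borel_measurable M" "v \<in> borel_measurable M"
  shows "(\<lambda>w. A w *v v w) \<in> borel_measurable M"
  unfolding matrix_vector_mult_def
  by (intro borel_measurable_vec_lambda borel_measurable_sum borel_measurable_times
      borel_measurable_vec_nth assms)

lemma borel_measurable_matrix_matrix_mult [measurable (raw)]:
  fixes A :: "'a \<Rightarrow> real^'n^'m"
  assumes "A \<in> borel_measurable M" "C \<in> borel_measurable M"
  shows "(\<lambda>w. A w ** C w) \<in> borel_measurable M"
  unfolding matrix_matrix_mult_def
  by (intro borel_measurable_vec_lambda borel_measurable_sum borel_measurable_times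
      borel_measurable_vec_nth assms)

lemma borel_measurable_outer [measurable (raw)]:
  fixes u :: "'a \<Rightarrow> real^'n"
  assumes "u \<in> borel_measurable M" "v \<in> borel_measurable M"
  shows "(\<lambda>w. outer (u w) (v w)) \<in> borel_measurable M"
  unfolding outer_def
  by (intro borel_measurable_vec_lambda borel_measurable_times borel_measurable_vec_nth assms)

lemma borel_measurable_bfgs_update [measurable (raw)]:
  assumes "A \<in> borel_measurable M" "s \<in> borel_measurable M" "y \<in> borel_measurable M"
  shows "(\<lambda>w. bfgs_update (A w) (s w) (y w) c) \<in> borel_measurable M"
  unfolding bfgs_update_def
  by (intro borel_measurable_add borel_measurable_diff borel_measurable_scaleR
      borel_measurable_divide borel_measurable_inner borel_measurable_matrix_vector_mult
      borel_measurable_matrix_matrix_mult borel_measurable_outer borel_measurable_const assms)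

lemma borel_measurable_det [measurable (raw)]:
  fixes A :: "'a \<Rightarrow> real^'n^'n"
  assumes "A \<in> borel_measurable M"
  shows "(\<lambda>w. det (A w)) \<in> borel_measurable M"
  unfolding det_def
  by (intro borel_measurable_sum borel_measurable_times borel_measurable_prod
      borel_measurable_const borel_measurable_vec_nth assms)

text \<open>Cramer's rule, applied to the columns of the inverse, exhibits its entries as quotients
  of determinants, hence as measurable functions of the entries of \<open>A\<close>.\<close>

lemma matrix_inv_entry:
  fixes A :: "real^'n^'n"
  assumes "invertible A"
  shows "matrix_inv A $ k $ l
    = det (\<chi> i j. if j = k then axis l 1 $ i else A $ i $ j) / det A"
proof -
  have "A *v (matrix_inv A *v axis l 1) = axis l 1"
    using matrix_mult_matrix_inv[OF assms] by (simp add: matrix_vector_mul_assoc)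
  then have "matrix_inv A *v axis l 1
      = (\<chi> k. det (\<chi> i j. if j = k then axis l 1 $ i else A $ i $ j) / det A)"
    using cramer[of A "matrix_inv A *v axis l 1" "axis l 1"] assms by (simp add: invertible_det_nz)
  then show ?thesis
    by (simp add: matrix_vector_mult_basis column_def vec_eq_iff)
qed

lemma borel_measurable_matrix_inv [measurable (raw)]:
  fixes A :: "'a \<Rightarrow> real^'n^'n"
  assumes [measurable]: "A \<in> borel_measurable M"
  shows "(\<lambda>w. matrix_inv (A w)) \<in> borel_measurable M"
proof -
  \<comment> \<open>For a singular matrix \<open>matrix_inv\<close> chooses from an unsatisfiable
    predicate. That predicate is the same for all singular matrices, so they share the one value
    \<open>Z\<close>, and the inverse is measurable piecewise.\<close>
  define Z :: "real^'n^'n" where "Z = (SOME A'. False)"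
  have "matrix_inv C = (if det C = 0 then Z
      else (\<chi> k l. det (\<chi> i j. if j = k then axis l 1 $ i else C $ i $ j) / det C))" for C :: "real^'n^'n"
  proof (cases "det C = 0")
    case True
    then have "\<not> invertible C" by (simp add: invertible_det_nz)
    then show ?thesis
      using True by (auto simp: invertible_def matrix_inv_def Z_def intro!: arg_cong[where f=Eps])
  next
    case False
    then show ?thesis by (simp add: vec_eq_iff matrix_inv_entry invertible_det_nz)
  qed
  then show ?thesis by simp
qed

text \<open>
  \<open>F y z\<close> is only regular in \<open>y\<close> for \<open>z \<in> Z\<close>, and \<open>Z\<close> need not be measurable, so neither \<open>F\<close>
  nor its gradient need be jointly measurable; they are replaced by versions that agree for
  \<open>z \<in> Z\<close>.
\<close>

lemma ex_jointly_measurable_version: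
  fixes F :: "'a::euclidean_space \<Rightarrow> 'b \<Rightarrow> real"
  assumes F: "\<And>y. F y \<in> borel_measurable N"
    and cont: "\<And>z. z \<in> Z \<Longrightarrow> continuous_on UNIV (\<lambda>y. F y z)"
  shows "\<exists>f. (\<lambda>(y, z). f y z) \<in> borel_measurable (borel \<Otimes>\<^sub>M N) \<and> (\<forall>y. \<forall>z\<in>Z. f y z = F y z)"
proof -
  \<comment> \<open>The maps \<open>q i\<close> have finite range and converge pointwise to the
    identity. Continuity in y therefore recovers \<open>F y z\<close> as the limit of
    \<open>F (q i y) z\<close> for z in \<open>Z\<close>.\<close>
  obtain q :: "nat \<Rightarrow> 'a \<Rightarrow> 'a" where q: "\<And>i. simple_function borel (q i)"
    and lim: "\<And>x. (\<lambda>i. q i x) \<longlonglongrightarrow> x"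
    using borel_measurable_implies_sequence_metric[of "\<lambda>x. x" borel 0] by auto
  define f where "f y z = lim (\<lambda>i. F (q i y) z)" for y z
  have "(\<lambda>p. F (q i (fst p)) (snd p)) \<in> borel_measurable (borel \<Otimes>\<^sub>M N)" for i
  \<comment> \<open>Since \<open>q i\<close> takes only finitely many values, measurability of each
    section \<open>F y\<close> suffices for the composite.\<close>
  proof (rule measurable_compose_countable'[where I = "range (q i)"])
    show "countable (range (q i))"
      using simple_functionD(1)[OF q[of i]] by (simp add: countable_finite)
    have "q i \<in> borel \<rightarrow>\<^sub>M count_space (range (q i))"
      using simple_functionD(1)[OF q[of i]] simple_functionD(2)[OF q[of i]]
      by (simp add: measurable_count_space_eq2)
    then show "(\<lambda>p. q i (fst p)) \<in> borel \<Otimes>\<^sub>M N \<rightarrow>\<^sub>M count_space (range (q i))"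
      by (rule measurable_compose[OF measurable_fst])
  qed (use F in measurable)
  then have "(\<lambda>(y, z). f y z) \<in> borel_measurable (borel \<Otimes>\<^sub>M N)"
    unfolding f_def split_beta by (rule borel_measurable_lim_metric)
  moreover have "f y z = F y z" if "z \<in> Z" for y z
  proof -
    have "isCont (\<lambda>y. F y z) y" using cont[OF that] by (simp add: continuous_on_eq_continuous_at)
    then show ?thesis
      unfolding f_def by (intro limI isCont_tendsto_compose[OF _ lim])
  qed
  ultimately show ?thesis by blast
qed

text \<open>A component of the gradient as the limit of a sequence, so that measurability of
  \<open>h\<close> in a parameter passes to the gradient.\<close>

lemma GDERIV_component_limit:
  fixes h :: "'a::real_inner \<Rightarrow> real"
  assumes "GDERIV h y :> D"
  shows "(\<lambda>m. (h (y + inverse (real (Suc m)) *\<^sub>R b) - h y) * real (Suc m)) \<longlonglongrightarrow> inner D b"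
proof -
  have "((\<lambda>t. h (y + t *\<^sub>R b)) has_real_derivative inner D b) (at 0)"
    by (rule GDERIV_line) (simp add: assms)
  then have "((\<lambda>t. (h (y + t *\<^sub>R b) - h y) / t) \<longlongrightarrow> inner D b) (at 0)"
    by (simp add: DERIV_def)
  moreover have "filterlim (\<lambda>m. inverse (real (Suc m))) (at 0) sequentially"
    using LIMSEQ_inverse_real_of_nat by (auto simp: filterlim_at simp del: of_nat_Suc)
  ultimately have "(\<lambda>m. (h (y + inverse (real (Suc m)) *\<^sub>R b) - h y) / inverse (real (Suc m)))
      \<longlonglongrightarrow> inner D b"
    by (rule filterlim_compose)
  then show ?thesis by (simp add: divide_inverse)
qed

text \<open>First \<open>F\<close> is replaced by a jointly measurable version, then the gradient is
  assembled from limits of its difference quotients. As \<open>lim\<close> is total,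
  \<open>g\<close> is defined and measurable also where these quotients diverge.\<close>

lemma ex_jointly_measurable_gradient:
  fixes F :: "'a::euclidean_space \<Rightarrow> 'b \<Rightarrow> real"
  assumes F: "\<And>y. F y \<in> borel_measurable N"
    and diff: "\<And>y z. z \<in> Z \<Longrightarrow> (\<lambda>y. F y z) differentiable (at y)"
  shows "\<exists>g. (\<lambda>(y, z). g y z) \<in> borel_measurable (borel \<Otimes>\<^sub>M N) \<and>
    (\<forall>y. \<forall>z\<in>Z. g y z = grad (\<lambda>u. F u z) y)"
proof -
  have "continuous_on UNIV (\<lambda>y. F y z)" if "z \<in> Z" for z
    using diff[OF that]
    by (intro continuous_at_imp_continuous_on ballI differentiable_imp_continuous_within)
  then obtain f where f: "(\<lambda>(y, z). f y z) \<in> borel_measurable (borel \<Otimes>\<^sub>M N)"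
    and fF: "\<And>y z. z \<in> Z \<Longrightarrow> f y z = F y z"
    using ex_jointly_measurable_version[of F N Z] F by blast
  define g where "g y z = (\<Sum>b\<in>Basis.
      lim (\<lambda>m. (f (y + inverse (real (Suc m)) *\<^sub>R b) z - f y z) * real (Suc m)) *\<^sub>R b)" for y z
  have [measurable]: "(\<lambda>p. f (h (fst p)) (snd p)) \<in> borel_measurable (borel \<Otimes>\<^sub>M N)"
    if [measurable]: "h \<in> borel_measurable borel" for h
    using measurable_compose[OF _ f, of "\<lambda>p. (h (fst p), snd p)" "borel \<Otimes>\<^sub>M N"] by simp
  have "(\<lambda>(y, z). g y z) \<in> borel_measurable (borel \<Otimes>\<^sub>M N)"
    unfolding g_def split_beta by measurable
  moreover have "g y z = grad (\<lambda>u. F u z) y" if z: "z \<in> Z" for y z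
  proof -
    have "lim (\<lambda>m. (f (y + inverse (real (Suc m)) *\<^sub>R b) z - f y z) * real (Suc m))
        = inner (grad (\<lambda>u. F u z) y) b" for b
      unfolding fF[OF z] by (intro limI GDERIV_component_limit GDERIV_grad diff z)
    then show ?thesis by (simp add: g_def euclidean_representation)
  qed
  ultimately show ?thesis by blast
qed

section \<open>Independence of the iterates from the next sample\<close>

text \<open>The natural filtration of the method. Only samples with index below k enter, because
  sample k is first used in computing x_{k+1}.\<close>

definition history :: "'w measure \<Rightarrow> ('w \<Rightarrow> 'a::topological_space) \<Rightarrow> (nat \<Rightarrow> 'w \<Rightarrow> 'b::topological_space)
    \<Rightarrow> nat \<Rightarrow> 'w measure" where
  "history M x0 xi k = sigma (space M)
     ({x0 -` A \<inter> space M |A. A \<in> sets borel} \<union> (\<Union>i<k. {xi i -` A \<inter> space M |A. A \<in> sets borel}))"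

lemma space_history [simp]: "space (history M x0 xi k) = space M"
  unfolding history_def by (rule space_measure_of) blast

lemma sets_history:
  "sets (history M x0 xi k) = sigma_sets (space M)
     ({x0 -` A \<inter> space M |A. A \<in> sets borel} \<union> (\<Union>i<k. {xi i -` A \<inter> space M |A. A \<in> sets borel}))"
  unfolding history_def by (rule sets_measure_of) blast

lemma history_mono:
  assumes "k \<le> l"
  shows "sets (history M x0 xi k) \<subseteq> sets (history M x0 xi l)"
proof -
  have "{..<k} \<subseteq> {..<l}" using assms by simp
  then show ?thesis
    unfolding sets_history by (intro sigma_sets_mono' Un_mono UN_mono order_refl)
qed

lemma measurable_history_start: "x0 \<in> borel_measurable (history M x0 xi k)"
proof (rule measurableI)
  show "x0 -` A \<inter> space (history M x0 xi k) \<in> sets (history M x0 xi k)" if "A \<in> sets borel" for A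
    unfolding sets_history space_history using that by (intro sigma_sets.Basic) blast
qed simp

lemma measurable_history_sample:
  assumes "i < k"
  shows "xi i \<in> borel_measurable (history M x0 xi k)"
proof (rule measurableI)
  show "xi i -` A \<inter> space (history M x0 xi k) \<in> sets (history M x0 xi k)" if "A \<in> sets borel" for A
    unfolding sets_history space_history using that assms by (intro sigma_sets.Basic) blast
qed simp

text \<open>The start is independent of the whole sample sequence, and the samples are mutually
  independent, so start and samples together form one independent family. Grouping its indices
  separates the history from sample k, and agreement on rectangles identifies the joint law with the
  product.\<close>

lemma (in prob_space) history_indep:
  fixes x0 :: "'a \<Rightarrow> 'b::topological_space" and xi :: "nat \<Rightarrow> 'a \<Rightarrow> 'c::topological_space"
  assumes x0: "x0 \<in> borel_measurable M"
    and indep: "indep_vars (\<lambda>_. borel) xi UNIV"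
    and x0_indep: "indep_set (sets (vimage_algebra (space M) x0 borel))
        (sets (vimage_algebra (space M) (\<lambda>w k. xi k w) (Pi\<^sub>M UNIV (\<lambda>_. borel))))"
    and X: "X \<in> history M x0 xi k \<rightarrow>\<^sub>M N"
  shows "X \<in> M \<rightarrow>\<^sub>M N"
    and "distr M N X \<Otimes>\<^sub>M distr M borel (xi k) = distr M (N \<Otimes>\<^sub>M borel) (\<lambda>w. (X w, xi k w))"
proof -
  \<comment> \<open>Indices are shifted by one: 0 stands for the start and \<open>Suc i\<close> for
    sample i.\<close>
  define E where "E i = (case i of 0 \<Rightarrow> {x0 -` A \<inter> space M |A. A \<in> sets borel}
      | Suc i \<Rightarrow> {xi i -` A \<inter> space M |A. A \<in> sets borel})" for i
  have xi[measurable]: "xi i \<in> borel_measurable M" for i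
    using indep by (simp add: indep_vars_def)
  have xi_indep: "indep_sets (\<lambda>i. {xi i -` A \<inter> space M |A. A \<in> sets borel}) UNIV"
    using indep by (simp add: indep_vars_def2)
  have E_Suc: "E (Suc i) \<subseteq> sets (vimage_algebra (space M) (\<lambda>w k. xi k w) (Pi\<^sub>M UNIV (\<lambda>_. borel)))" for i
  proof
    fix S assume "S \<in> E (Suc i)"
    then obtain A where A: "A \<in> sets borel" and S: "S = xi i -` A \<inter> space M" by (auto simp: E_def)
    have "(\<lambda>p. p i) -` A \<inter> space (Pi\<^sub>M UNIV (\<lambda>_. borel)) \<in> sets (Pi\<^sub>M UNIV (\<lambda>_. borel :: 'c measure))"
      using A by (intro measurable_sets[OF measurable_component_singleton]) auto
    from in_vimage_algebra[OF this, of "\<lambda>w k. xi k w" "space M"]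
    show "S \<in> sets (vimage_algebra (space M) (\<lambda>w k. xi k w) (Pi\<^sub>M UNIV (\<lambda>_. borel)))"
      unfolding S by (simp add: space_PiM vimage_def)
  qed
  have x0_set: "E 0 \<subseteq> sets (vimage_algebra (space M) x0 borel)"
    by (auto simp: E_def intro: in_vimage_algebra)
  have "indep_sets E UNIV"
  proof (rule indep_setsI)
    show "E i \<subseteq> events" for i
      using x0 by (cases i) (auto simp: E_def)
    fix A J assume J: "J \<noteq> {}" "finite J" and A: "\<forall>j\<in>J. A j \<in> E j"
    \<comment> \<open>The sample indices in \<open>J\<close>, shifted back. Independence of the
      start splits off a possible factor at 0; independence of the samples factors the rest.\<close>
    define J' where "J' = {i. Suc i \<in> J}"
    have fin: "finite J'"
      unfolding J'_def using finite_vimageI[OF \<open>finite J\<close>, of Suc] by (simp add: vimage_def)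
    have pos: "prob (\<Inter>i\<in>J'. A (Suc i)) = (\<Prod>i\<in>J'. prob (A (Suc i)))" if "J' \<noteq> {}"
    proof (rule indep_setsD[OF xi_indep])
      show "\<forall>j\<in>J'. A (Suc j) \<in> {xi j -` A \<inter> space M |A. A \<in> sets borel}"
        using A by (auto simp: J'_def E_def)
    qed (use that fin in auto)
    have J_eq: "J - {0} = Suc ` J'"
    proof (rule set_eqI)
      show "j \<in> J - {0} \<longleftrightarrow> j \<in> Suc ` J'" for j
        by (cases j) (auto simp: J'_def)
    qed
    show "prob (\<Inter>j\<in>J. A j) = (\<Prod>j\<in>J. prob (A j))"
    proof (cases "0 \<in> J")
      case False
      then have "J = Suc ` J'" using J_eq by auto
      then show ?thesis using pos J(1) by (auto simp: prod.reindex)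
    next
      case True
      then have J0: "J = insert 0 (Suc ` J')" using J_eq by auto
      show ?thesis
      proof (cases "J' = {}")
        case True
        then show ?thesis using J0 by simp
      next
        case False
        have "(\<Inter>i\<in>J'. A (Suc i)) \<in> sets (vimage_algebra (space M) (\<lambda>w k. xi k w) (Pi\<^sub>M UNIV (\<lambda>_. borel)))"
          using False fin A E_Suc by (intro sets.finite_INT) (auto simp: J'_def)
        moreover have "A 0 \<in> sets (vimage_algebra (space M) x0 borel)"
          using A True x0_set by auto
        ultimately have "prob (A 0 \<inter> (\<Inter>i\<in>J'. A (Suc i))) = prob (A 0) * prob (\<Inter>i\<in>J'. A (Suc i))"
          using x0_indep by (auto simp: indep_sets2_eq)
        then show ?thesis using J0 pos[OF False] fin by (simp add: prod.reindex)
      qed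
    qed
  qed
  \<comment> \<open>Two blocks of indices, encoded by a boolean: \<open>True\<close> for the start
    and the samples before k, \<open>False\<close> for sample k alone.\<close>
  then have "indep_sets E (\<Union>b\<in>UNIV. case b of True \<Rightarrow> {..k} | False \<Rightarrow> {Suc k})"
    by (rule indep_sets_mono_index[rotated]) simp
  then have "indep_sets (\<lambda>b. sigma_sets (space M)
      (\<Union>i\<in>(case b of True \<Rightarrow> {..k} | False \<Rightarrow> {Suc k}). E i)) UNIV"
  proof (rule indep_sets_collect_sigma)
    show "Int_stable (E i)" for i
    proof (cases i)
      case 0
      have "\<exists>C. x0 -` A \<inter> space M \<inter> (x0 -` A' \<inter> space M) = x0 -` C \<inter> space M \<and> C \<in> sets borel"
        if "A \<in> sets borel" "A' \<in> sets borel" for A A'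
        using that by (intro exI[of _ "A \<inter> A'"]) auto
      then show ?thesis using 0 by (auto simp: E_def Int_stable_def)
    next
      case (Suc j)
      have "\<exists>C. xi j -` A \<inter> space M \<inter> (xi j -` A' \<inter> space M) = xi j -` C \<inter> space M \<and> C \<in> sets borel"
        if "A \<in> sets borel" "A' \<in> sets borel" for A A'
        using that by (intro exI[of _ "A \<inter> A'"]) auto
      then show ?thesis using Suc by (auto simp: E_def Int_stable_def)
    qed
  qed (auto simp: disjoint_family_on_def split: bool.splits)
  then have ind: "indep_set (sigma_sets (space M) (\<Union>i\<in>{..k}. E i)) (sigma_sets (space M) (E (Suc k)))"
    unfolding indep_set_def by (rule back_subst[of "\<lambda>f. indep_sets f UNIV"]) (auto simp: fun_eq_iff split: bool.split)
  have "{..k} = insert 0 (Suc ` {..<k})"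
    unfolding lessThan_Suc_atMost[symmetric] by (rule lessThan_Suc_eq_insert_0)
  then have "sigma_sets (space M) (\<Union>i\<in>{..k}. E i) = sets (history M x0 xi k)"
    unfolding sets_history by (simp add: E_def)
  with ind have ind': "indep_set (sets (history M x0 xi k)) (sigma_sets (space M) {xi k -` A \<inter> space M |A. A \<in> sets borel})"
    by (simp add: E_def)
  then have hist: "sets (history M x0 xi k) \<subseteq> events"
    by (simp add: indep_sets2_eq)
  show X_M [measurable]: "X \<in> M \<rightarrow>\<^sub>M N"
    using X hist by (auto simp: measurable_def)
  show "distr M N X \<Otimes>\<^sub>M distr M borel (xi k) = distr M (N \<Otimes>\<^sub>M borel) (\<lambda>w. (X w, xi k w))"
  proof (rule pair_measure_eqI)
    show "sigma_finite_measure (distr M N X)" "sigma_finite_measure (distr M borel (xi k))"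
      by (auto intro!: prob_space_imp_sigma_finite prob_space_distr)
    show "emeasure (distr M N X) A * emeasure (distr M borel (xi k)) A'
        = emeasure (distr M (N \<Otimes>\<^sub>M borel) (\<lambda>w. (X w, xi k w))) (A \<times> A')"
      if "A \<in> sets (distr M N X)" "A' \<in> sets (distr M borel (xi k))" for A A'
    proof -
      have A: "A \<in> sets N" "A' \<in> sets borel" using that by auto
      have "X -` A \<inter> space M \<in> sets (history M x0 xi k)"
        using measurable_sets[OF X A(1)] by simp
      moreover have "xi k -` A' \<inter> space M \<in> sigma_sets (space M) {xi k -` A \<inter> space M |A. A \<in> sets borel}"
        using A(2) by (intro sigma_sets.Basic) blast
      ultimately have "prob ((X -` A \<inter> space M) \<inter> (xi k -` A' \<inter> space M))
          = prob (X -` A \<inter> space M) * prob (xi k -` A' \<inter> space M)"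
        using ind' unfolding indep_sets2_eq by blast
      moreover have "(\<lambda>w. (X w, xi k w)) -` (A \<times> A') \<inter> space M
          = (X -` A \<inter> space M) \<inter> (xi k -` A' \<inter> space M)"
        by auto
      ultimately show ?thesis
        using A by (simp add: emeasure_distr emeasure_eq_measure ennreal_mult)
    qed
  qed simp
qed

text \<open>The freezing argument: with a product law, Tonelli's theorem integrates out
  \<open>Y\<close> with \<open>X\<close> held fixed. Replacing \<open>Y\<close> by the
  equidistributed \<open>Y'\<close> leads from sample k to the generic vector for which the moment
  assumptions are stated.\<close>

lemma (in prob_space) nn_integral_joint_distr:
  assumes XY: "X \<in> M \<rightarrow>\<^sub>M S" "Y \<in> M \<rightarrow>\<^sub>M T"
    and joint: "distr M S X \<Otimes>\<^sub>M distr M T Y = distr M (S \<Otimes>\<^sub>M T) (\<lambda>w. (X w, Y w))"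
    and Y': "distr M T Y' = distr M T Y" "Y' \<in> M \<rightarrow>\<^sub>M T"
    and [measurable]: "(\<lambda>(a, b). \<phi> a b) \<in> borel_measurable (S \<Otimes>\<^sub>M T)"
  shows "(\<integral>\<^sup>+w. \<phi> (X w) (Y w) \<partial>M) = (\<integral>\<^sup>+w. (\<integral>\<^sup>+w'. \<phi> (X w) (Y' w') \<partial>M) \<partial>M)"
proof -
  have [measurable]: "X \<in> M \<rightarrow>\<^sub>M S" "Y \<in> M \<rightarrow>\<^sub>M T" "Y' \<in> M \<rightarrow>\<^sub>M T"
    by (rule XY Y'(2))+
  interpret T: prob_space "distr M T Y" by (rule prob_space_distr) simp
  have "(\<integral>\<^sup>+w. \<phi> (X w) (Y w) \<partial>M) = (\<integral>\<^sup>+p. (case p of (a, b) \<Rightarrow> \<phi> a b) \<partial>(distr M S X \<Otimes>\<^sub>M distr M T Y))"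
    by (simp add: joint nn_integral_distr)
  also have "\<dots> = (\<integral>\<^sup>+a. (\<integral>\<^sup>+b. \<phi> a b \<partial>distr M T Y) \<partial>distr M S X)"
    by (subst T.nn_integral_fst[symmetric]) auto
  also have "\<dots> = (\<integral>\<^sup>+w. (\<integral>\<^sup>+b. \<phi> (X w) b \<partial>distr M T Y) \<partial>M)"
    by (subst nn_integral_distr) (auto intro!: T.borel_measurable_nn_integral)
  also have "\<dots> = (\<integral>\<^sup>+w. (\<integral>\<^sup>+w'. \<phi> (X w) (Y' w') \<partial>M) \<partial>M)"
    unfolding Y'(1)[symmetric]
    by (intro nn_integral_cong nn_integral_distr) (auto dest: measurable_space)
  finally show ?thesis .
qed

section \<open>The expected one-step decrease\<close>

text \<open>With the state frozen, the step is -\<gamma> H (p + e), where p is the regularized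
  gradient and e is centred noise. Half of the decrease \<gamma> \<delta> |p|^2 absorbs the
  quadratic term of the descent lemma; gradient domination turns the other half into a contraction.
  As \<open>y'\<close> minimizes \<open>f\<close> and not the regularized function, a term in |y'|^2
  remains.\<close>

lemma (in prob_space) regularized_expected_decrease:
  fixes f :: "real^'n \<Rightarrow> real" and H :: "real^'n^'n" and G :: "'a \<Rightarrow> real^'n"
  assumes D: "\<And>y. GDERIV f y :> D y" and lip: "L-lipschitz_on UNIV D" and conv: "convex_on UNIV f"
    and min: "\<And>y. f y' \<le> f y" and m: "0 < m" and L: "0 \<le> L"
    and G: "integrable M G" "(\<integral>w. G w \<partial>M) = D u"
    and var: "(\<integral>\<^sup>+w. ennreal ((norm (G w - D u))\<^sup>2) \<partial>M) \<le> ennreal (\<nu>\<^sup>2)"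
    and H: "\<And>v. \<delta> * (norm v)\<^sup>2 \<le> inner v (H *v v)" "\<And>v. norm (H *v v) \<le> \<Lambda> * norm v"
    and \<gamma>: "0 \<le> \<gamma>" "(L + m) * \<gamma> * \<Lambda>\<^sup>2 \<le> \<delta>"
  shows "(\<integral>\<^sup>+w. ennreal (regularized f m (u - \<gamma> *\<^sub>R (H *v (G w + m *\<^sub>R u))) - f y') \<partial>M)
    \<le> ennreal ((1 - \<gamma> * \<delta> * m) * (regularized f m u - f y')
        + \<gamma> * \<delta> * m\<^sup>2 / 2 * (norm y')\<^sup>2 + (L + m) / 2 * \<gamma>\<^sup>2 * \<Lambda>\<^sup>2 * \<nu>\<^sup>2)"
proof -
  define p where "p = D u + m *\<^sub>R u"
  define e where "e w = G w - D u" for w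
  define c where "c = (L + m) / 2 * \<gamma>\<^sup>2 * \<Lambda>\<^sup>2"
  \<comment> \<open>Moving \<open>H\<close> to the other side makes the cross term <p, H e> linear
    in the noise with a fixed coefficient, so its expectation is zero.\<close>
  define q where "q = transpose H *v p"
  have c: "0 \<le> c" using L m by (simp add: c_def)
  have e: "integrable M e" and e0: "(\<integral>w. e w \<partial>M) = 0"
    using G by (auto simp: e_def[abs_def] prob_space)
  have e_meas[measurable]: "e \<in> borel_measurable M" using e by (rule borel_measurable_integrable)
  have fin: "(\<integral>\<^sup>+w. ennreal ((norm (e w))\<^sup>2) \<partial>M) \<le> ennreal (\<nu>\<^sup>2)" using var by (simp add: e_def)
  have e2: "integrable M (\<lambda>w. (norm (e w))\<^sup>2)"
    by (rule integrableI_nonneg) (use fin in \<open>auto intro: le_less_trans\<close>)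
  have "ennreal (\<integral>w. (norm (e w))\<^sup>2 \<partial>M) \<le> ennreal (\<nu>\<^sup>2)"
    using fin by (subst nn_integral_eq_integral[OF e2, symmetric]) auto
  then have e2_le: "(\<integral>w. (norm (e w))\<^sup>2 \<partial>M) \<le> \<nu>\<^sup>2"
    by (simp add: ennreal_le_iff)
  have bound: "regularized f m (u - \<gamma> *\<^sub>R (H *v (G w + m *\<^sub>R u)))
      \<le> regularized f m u - \<gamma> * inner p (H *v p) - \<gamma> * inner q (e w)
        + c * ((norm p)\<^sup>2 + 2 * inner p (e w) + (norm (e w))\<^sup>2)" for w
  proof -
    let ?d = "- \<gamma> *\<^sub>R (H *v (p + e w))"
    have "G w + m *\<^sub>R u = p + e w" by (simp add: p_def e_def)
    then have "regularized f m (u - \<gamma> *\<^sub>R (H *v (G w + m *\<^sub>R u))) = regularized f m (u + ?d)" by simp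
    also have "\<dots> \<le> regularized f m u + inner p ?d + (L + m) / 2 * (norm ?d)\<^sup>2"
      unfolding p_def by (rule regularized_descent[OF D lip])
    also have "inner p ?d = - \<gamma> * inner p (H *v p) - \<gamma> * inner q (e w)"
      unfolding q_def
      by (simp add: matrix_vector_right_distrib inner_add_right algebra_simps dot_lmul_matrix[symmetric])
    also have "(L + m) / 2 * (norm ?d)\<^sup>2 \<le> (L + m) / 2 * (\<gamma> * (\<Lambda> * norm (p + e w)))\<^sup>2"
      using L m \<gamma>(1) H(2)[of "p + e w"] by (intro mult_left_mono power_mono) (auto intro: mult_left_mono)
    also have "(L + m) / 2 * (\<gamma> * (\<Lambda> * norm (p + e w)))\<^sup>2 = c * (norm (p + e w))\<^sup>2"
      by (simp add: c_def power_mult_distrib)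
    finally show ?thesis unfolding norm_add_squared by simp
  qed
  let ?U = "\<lambda>w. regularized f m u - \<gamma> * inner p (H *v p) - \<gamma> * inner q (e w)
        + c * ((norm p)\<^sup>2 + 2 * inner p (e w) + (norm (e w))\<^sup>2) - f y'"
  have U: "integrable M ?U" using e e2 by simp
  have nonneg: "0 \<le> regularized f m v - f y'" for v
    using min[of v] m by (simp add: regularized_def add_increasing2)
  have "(\<integral>\<^sup>+w. ennreal (regularized f m (u - \<gamma> *\<^sub>R (H *v (G w + m *\<^sub>R u))) - f y') \<partial>M)
      \<le> (\<integral>\<^sup>+w. ennreal (?U w) \<partial>M)"
    using bound by (intro nn_integral_mono ennreal_leI) (simp add: diff_right_mono)
  \<comment> \<open>The majorant \<open>?U\<close> is integrable and, lying above a nonnegative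
    function, nonnegative itself; hence its extended integral is an ordinary one.\<close>
  also have "\<dots> = ennreal (\<integral>w. ?U w \<partial>M)"
  proof (rule nn_integral_eq_integral[OF U])
    show "AE w in M. 0 \<le> ?U w"
      using order_trans[OF nonneg diff_right_mono[OF bound]] by simp
  qed
  also have "(\<integral>w. ?U w \<partial>M) = regularized f m u - \<gamma> * inner p (H *v p)
      + c * ((norm p)\<^sup>2 + (\<integral>w. (norm (e w))\<^sup>2 \<partial>M)) - f y'"
    using e e2 by (simp add: e0 prob_space)
  also have "ennreal \<dots> \<le> ennreal ((1 - \<gamma> * \<delta> * m) * (regularized f m u - f y')
      + \<gamma> * \<delta> * m\<^sup>2 / 2 * (norm y')\<^sup>2 + c * \<nu>\<^sup>2)"
  proof (rule ennreal_leI)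
    have \<delta>: "0 \<le> \<delta>" using \<gamma> L m by (meson add_nonneg_nonneg less_imp_le mult_nonneg_nonneg order_trans zero_le_power2)
    have 1: "\<gamma> * (\<delta> * (norm p)\<^sup>2) \<le> \<gamma> * inner p (H *v p)"
      using H(1) \<gamma>(1) by (rule mult_left_mono)
    have 2: "c * (\<integral>w. (norm (e w))\<^sup>2 \<partial>M) \<le> c * \<nu>\<^sup>2"
      using e2_le c by (rule mult_left_mono)
    \<comment> \<open>The step-size condition bounds the quadratic term in p by half of the
      guaranteed decrease.\<close>
    have "c * (norm p)\<^sup>2 = \<gamma> / 2 * ((L + m) * \<gamma> * \<Lambda>\<^sup>2) * (norm p)\<^sup>2"
      by (simp add: c_def power2_eq_square)
    also have "\<dots> \<le> \<gamma> / 2 * \<delta> * (norm p)\<^sup>2"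
      using \<gamma> by (intro mult_left_mono mult_right_mono) auto
    finally have 3: "c * (norm p)\<^sup>2 \<le> \<gamma> / 2 * \<delta> * (norm p)\<^sup>2" .
    have "\<gamma> / 2 * \<delta> * (2 * m * (regularized f m u - regularized f m y')) \<le> \<gamma> / 2 * \<delta> * (norm p)\<^sup>2"
      unfolding p_def using \<gamma>(1) \<delta>
      by (intro mult_left_mono regularized_gradient_dominated[OF conv D m]) auto
    then have 4: "\<gamma> * \<delta> * m * (regularized f m u - f y' - m / 2 * (norm y')\<^sup>2) \<le> \<gamma> / 2 * \<delta> * (norm p)\<^sup>2"
      by (simp add: regularized_def algebra_simps)
    have "\<gamma> * \<delta> * m * (m / 2 * (norm y')\<^sup>2) = \<gamma> * \<delta> * m\<^sup>2 / 2 * (norm y')\<^sup>2"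
      by (simp add: power2_eq_square[of m])
    with 1 2 3 4 show "regularized f m u - \<gamma> * inner p (H *v p)
        + c * ((norm p)\<^sup>2 + (\<integral>w. (norm (e w))\<^sup>2 \<partial>M)) - f y'
      \<le> (1 - \<gamma> * \<delta> * m) * (regularized f m u - f y')
        + \<gamma> * \<delta> * m\<^sup>2 / 2 * (norm y')\<^sup>2 + c * \<nu>\<^sup>2"
      by (simp add: algebra_simps power2_eq_square[of m])
  qed
  finally show ?thesis by (simp add: c_def)
qed

section \<open>Extended expectations of variables bounded below\<close>

text \<open>Connects the expectations in the final statement with the nonnegative integrals used in
  the estimates. If X - c is not integrable, the lower bound still keeps the negative part finite,
  so both sides are infinite.\<close>

lemma (in prob_space) expect_ext_diff_lower_bound:
  assumes X[measurable]: "X \<in> borel_measurable M" and lower: "\<And>w. w \<in> space M \<Longrightarrow> c \<le> X w"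
  shows "expect_ext M X - ereal c = enn2ereal (\<integral>\<^sup>+w. ennreal (X w - c) \<partial>M)"
proof (cases "(\<integral>\<^sup>+w. ennreal (X w - c) \<partial>M) < \<infinity>")
  case True
  have Y: "integrable M (\<lambda>w. X w - c)"
    by (rule integrableI_nonneg) (use True lower in auto)
  then have "integrable M (\<lambda>w. (X w - c) + c)" by (intro Bochner_Integration.integrable_add) auto
  then have "integrable M X" by simp
  then have "expect_ext M X = ereal (\<integral>w. X w \<partial>M)" by (rule expect_ext_integrable)
  moreover have "(\<integral>\<^sup>+w. ennreal (X w - c) \<partial>M) = ennreal (\<integral>w. (X w - c) \<partial>M)"
    using lower by (intro nn_integral_eq_integral[OF Y]) auto
  moreover have "0 \<le> (\<integral>w. (X w - c) \<partial>M)" using lower by (intro integral_nonneg_AE) auto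
  moreover have "(\<integral>w. (X w - c) \<partial>M) = (\<integral>w. X w \<partial>M) - c"
    using \<open>integrable M X\<close> by (simp add: prob_space)
  ultimately show ?thesis by (simp add: enn2ereal_ennreal)
next
  case False
  have "(\<integral>\<^sup>+w. ennreal (- X w) \<partial>M) \<le> (\<integral>\<^sup>+w. ennreal \<bar>c\<bar> \<partial>M)"
    using lower by (intro nn_integral_mono ennreal_leI) fastforce
  also have "\<dots> = ennreal \<bar>c\<bar>" by (simp add: emeasure_space_1)
  finally obtain b where b: "(\<integral>\<^sup>+w. ennreal (- X w) \<partial>M) = ennreal b" "0 \<le> b"
    by (metis ennreal_cases ennreal_neq_top top.extremum_unique)
  have "(\<integral>\<^sup>+w. ennreal (X w - c) \<partial>M) \<le> (\<integral>\<^sup>+w. ennreal (X w) + ennreal \<bar>c\<bar> \<partial>M)"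
  proof (intro nn_integral_mono)
    fix w
    show "ennreal (X w - c) \<le> ennreal (X w) + ennreal \<bar>c\<bar>"
    proof (cases "0 \<le> X w")
      case True
      then have "ennreal (X w) + ennreal \<bar>c\<bar> = ennreal (X w + \<bar>c\<bar>)" by simp
      then show ?thesis by (simp only:) (intro ennreal_leI, simp)
    next
      case False
      then have "ennreal (X w - c) \<le> ennreal \<bar>c\<bar>" by (intro ennreal_leI) simp
      then show ?thesis by (rule add_increasing[OF zero_le])
    qed
  qed
  also have "\<dots> = (\<integral>\<^sup>+w. ennreal (X w) \<partial>M) + ennreal \<bar>c\<bar>"
    by (simp add: nn_integral_add emeasure_space_1)
  finally have "(\<integral>\<^sup>+w. ennreal (X w) \<partial>M) = \<infinity>"
    using False by (auto simp: not_less top_unique)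
  then show ?thesis
    using False b by (simp add: expect_ext_def less_top[symmetric] enn2ereal_ennreal)
qed

section \<open>Propagation of the rate along the recursion\<close>

text \<open>The induction rests on (1 - t)(1 + \<alpha> t) + (1 - \<alpha>) t = 1 - \<alpha> t^2
  \<le> 1, together with C \<le> \<theta> (1 - \<alpha>).\<close>

lemma contraction_rate:
  fixes E :: "nat \<Rightarrow> ennreal" and r t :: "nat \<Rightarrow> real"
  assumes r: "\<And>k. k \<ge> K \<Longrightarrow> 0 < r k" and t: "\<And>k. k \<ge> K \<Longrightarrow> 0 \<le> t k \<and> t k \<le> 1"
    and \<alpha>: "0 \<le> \<alpha>" "\<alpha> < 1" and C: "0 \<le> C"
    and step: "\<And>k. k \<ge> K \<Longrightarrow> E (Suc k) \<le> ennreal (1 - t k) * E k + ennreal (C * t k * r k)"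
    and ratio: "\<And>k. k \<ge> K \<Longrightarrow> r k \<le> r (Suc k) * (1 + \<alpha> * t (Suc k))"
    and \<theta>: "C / (1 - \<alpha>) \<le> \<theta>" and base: "E (Suc K) \<le> ennreal (\<theta> * r K)"
    and k: "k \<ge> K"
  shows "E (Suc k) \<le> ennreal (\<theta> * r k)"
  using k
proof (induction k rule: dec_induct)
  case base
  then show ?case by (rule assms)
next
  case (step k)
  let ?t = "t (Suc k)" and ?r = "r (Suc k)"
  have rt: "0 < ?r" "0 \<le> ?t" "?t \<le> 1" using r[of "Suc k"] t[of "Suc k"] step by auto
  have C\<theta>: "C \<le> \<theta> * (1 - \<alpha>)" using \<theta> \<alpha> by (simp add: field_simps)
  have \<theta>0: "0 \<le> \<theta>" using \<theta> C \<alpha> by (meson divide_nonneg_nonneg diff_ge_0_iff_ge less_imp_le order_trans)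
  have "E (Suc (Suc k)) \<le> ennreal (1 - ?t) * E (Suc k) + ennreal (C * ?t * ?r)"
    using assms(6) step by simp
  also have "\<dots> \<le> ennreal (1 - ?t) * ennreal (\<theta> * r k) + ennreal (C * ?t * ?r)"
    using step by (intro add_right_mono mult_left_mono) auto
  also have "\<dots> = ennreal ((1 - ?t) * (\<theta> * r k) + C * ?t * ?r)"
    using rt \<theta>0 C r[of k] step by (simp add: ennreal_mult ennreal_plus)
  also have "\<dots> \<le> ennreal (\<theta> * ?r)"
  proof (rule ennreal_leI)
    have "(1 - ?t) * (\<theta> * r k) \<le> (1 - ?t) * (\<theta> * (?r * (1 + \<alpha> * ?t)))"
      using rt \<theta>0 ratio[of k] step by (intro mult_left_mono) auto
    moreover have "C * ?t * ?r \<le> \<theta> * (1 - \<alpha>) * ?t * ?r"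
      using C\<theta> rt by (intro mult_right_mono) auto
    moreover have "0 \<le> \<theta> * ?r * \<alpha> * ?t * ?t" using \<theta>0 rt \<alpha> by simp
    ultimately show "(1 - ?t) * (\<theta> * r k) + C * ?t * ?r \<le> \<theta> * ?r"
      by (simp add: algebra_simps)
  qed
  finally show ?case .
qed

section \<open>Lower bound and measurability for the iterates\<close>

text \<open>An even update restores the margin \<rho> \<mu>_k by adding that multiple of the
  identity; an odd one changes nothing. Since \<mu> never increases, the margin at k covers the one
  demanded at k + 1.\<close>

lemma cr_sqn_matrix_lower_bound:
  fixes x :: "nat \<Rightarrow> 'w \<Rightarrow> real^'n"
  assumes alg: "cr_sqn \<Omega> G xi \<gamma> \<delta> \<mu> \<rho> B0 x B" and w: "w \<in> \<Omega>"
    and mono: "\<And>k u v. 0 \<le> inner (G u (xi k w) - G v (xi k w)) (u - v)"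
    and \<rho>: "0 \<le> \<rho>" "\<rho> \<le> 1" and \<mu>: "\<And>k. 0 \<le> \<mu> k" "\<And>k. \<mu> (Suc k) \<le> \<mu> k"
    and B0: "psd (B0 - (\<rho> * \<mu> 0) *\<^sub>R mat 1)"
  shows "psd (B k w - (\<rho> * \<mu> k) *\<^sub>R mat 1)"
proof (induction k)
  case 0
  then show ?case using alg w B0 by (simp add: cr_sqn_def)
next
  case (Suc k)
  then have sym: "transpose (B k w) = B k w"
    and low: "\<rho> * \<mu> k * (norm v)\<^sup>2 \<le> inner v (B k w *v v)" for v
    by (auto simp: psd_diff_mat_iff)
  have nn: "0 \<le> inner v (B k w *v v)" for v
    by (rule order_trans[OF _ low]) (simp add: \<rho> \<mu>)
  have "psd (B (Suc k) w - (\<rho> * \<mu> k) *\<^sub>R mat 1)"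
  proof (cases "even k")
    case True
    define s where "s = x (Suc k) w - x k w"
    define y where "y = G (x (Suc k) w) (xi k w) - G (x k w) (xi k w) + ((1 - \<rho>) * \<mu> k) *\<^sub>R s"
    have "B (Suc k) w = bfgs_update (B k w) s y (\<rho> * \<mu> k)"
      using alg w True by (simp add: cr_sqn_def Let_def s_def y_def)
    \<comment> \<open>Both gradients in \<open>y\<close> use the same sample, so monotonicity
      applies; the regularizing part adds a nonnegative multiple of |s|^2.\<close>
    moreover have "0 \<le> inner s y"
      using mono[of "x (Suc k) w" k "x k w"] \<rho> \<mu>(1)[of k]
      by (simp add: y_def s_def inner_add_right inner_commute)
    ultimately show ?thesis using psd_bfgs_update[OF sym nn] by simp
  next
    case False
    then show ?thesis using alg w Suc by (simp add: cr_sqn_def)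
  qed
  moreover have "\<rho> * \<mu> (Suc k) * (norm v)\<^sup>2 \<le> \<rho> * \<mu> k * (norm v)\<^sup>2" for v :: "real^'n"
    using \<rho> \<mu>(2) by (intro mult_right_mono mult_left_mono) auto
  ultimately show ?case by (auto simp: psd_diff_mat_iff intro: order_trans)
qed

text \<open>Each step applies measurable operations to the previous pair and sample k, once the
  sampled gradient is exchanged for its jointly measurable version. The matrix update reuses sample
  k at x_{k+1}, which is still within the history up to k + 1.\<close>

lemma cr_sqn_measurable_history:
  fixes xi :: "nat \<Rightarrow> 'w \<Rightarrow> 'z::second_countable_topology"
  assumes alg: "cr_sqn (space M) G xi \<gamma> \<delta> \<mu> \<rho> B0 x B"
    and g: "(\<lambda>(y, z). g y z) \<in> borel_measurable (borel \<Otimes>\<^sub>M borel)"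
    and gG: "\<And>y k w. w \<in> space M \<Longrightarrow> G y (xi k w) = g y (xi k w)"
  shows "x k \<in> borel_measurable (history M (x 0) xi k) \<and> B k \<in> borel_measurable (history M (x 0) xi k)"
proof (induction k)
  case 0
  have "B 0 \<in> borel_measurable (history M (x 0) xi 0) \<longleftrightarrow> (\<lambda>w. B0) \<in> borel_measurable (history M (x 0) xi 0)"
    using alg by (intro measurable_cong) (simp add: cr_sqn_def)
  then show ?case by (simp add: measurable_history_start)
next
  case (Suc k)
  define N where "N = history M (x 0) xi (Suc k)"
  have N: "space N = space M" by (simp add: N_def)
  have le: "sets (history M (x 0) xi k) \<subseteq> sets N" unfolding N_def by (rule history_mono) simp
  have [measurable]: "x k \<in> borel_measurable N" "B k \<in> borel_measurable N"
    using Suc le by (auto simp: measurable_def N)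
  have [measurable]: "xi k \<in> borel_measurable N" unfolding N_def by (rule measurable_history_sample) simp
  have [measurable]: "(\<lambda>w. g (h w) (xi k w)) \<in> borel_measurable N"
    if [measurable]: "h \<in> borel_measurable N" for h
    using measurable_compose[OF _ g, of "\<lambda>w. (h w, xi k w)" N] by simp
  have x_iff: "x (Suc k) \<in> borel_measurable N \<longleftrightarrow> (\<lambda>w. x k w - \<gamma> k *\<^sub>R ((matrix_inv (B k w) + \<delta> k *\<^sub>R mat 1)
                          *v (g (x k w) (xi k w) + \<mu> k *\<^sub>R x k w))) \<in> borel_measurable N"
    using alg by (intro measurable_cong) (simp add: cr_sqn_def N gG)
  have xS[measurable]: "x (Suc k) \<in> borel_measurable N"
    by (rule x_iff[THEN iffD2]) measurable
  have B_iff: "B (Suc k) \<in> borel_measurable N \<longleftrightarrow> (\<lambda>w. if even k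
      then bfgs_update (B k w) (x (Suc k) w - x k w) (g (x (Suc k) w) (xi k w) - g (x k w) (xi k w)
        + ((1 - \<rho>) * \<mu> k) *\<^sub>R (x (Suc k) w - x k w)) (\<rho> * \<mu> k)
      else B k w) \<in> borel_measurable N"
    using alg by (intro measurable_cong) (simp add: cr_sqn_def N gG Let_def)
  have "B (Suc k) \<in> borel_measurable N"
    by (rule B_iff[THEN iffD2]) measurable
  with xS show ?case by (simp add: N_def)
qed

section \<open>Assembly of the convergence rate\<close>

theorem theorem2:
  fixes M :: "'w measure"
    and \<xi> :: "'w \<Rightarrow> real^'d"
    and xi :: "nat \<Rightarrow> 'w \<Rightarrow> real^'d"
    and \<Xi> :: "(real^'d) set"
    and F :: "real^'n \<Rightarrow> real^'d \<Rightarrow> real"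
    and f :: "real^'n \<Rightarrow> real"
    and x :: "nat \<Rightarrow> 'w \<Rightarrow> real^'n"
    and B :: "nat \<Rightarrow> 'w \<Rightarrow> real^'n^'n"
    and B0 :: "real^'n^'n"
    and \<gamma> \<delta> \<mu> :: "nat \<Rightarrow> real"
    and \<rho> L \<nu> \<alpha> \<B> :: real
  assumes prob: "prob_space M"
    \<comment> \<open>the random vector, its samples, and the set \<open>\<Xi>\<close> containing all their realizations\<close>
    and xi_meas: "\<xi> \<in> borel_measurable M"
    and realizations: "\<forall>w\<in>space M. \<xi> w \<in> \<Xi>" "\<forall>k. \<forall>w\<in>space M. xi k w \<in> \<Xi>"
    and F_meas: "\<forall>y. F y \<in> borel_measurable borel"
    and F_int: "\<forall>y. integrable M (\<lambda>w. F y (\<xi> w))"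
    and f_eq: "f = (\<lambda>y. \<integral>w. F y (\<xi> w) \<partial>M)"
    and F_diff: "\<forall>z\<in>\<Xi>. \<forall>y. (\<lambda>y. F y z) differentiable (at y)"
    \<comment> \<open>(A1)\<close>
    and F_convex: "\<forall>z\<in>\<Xi>. convex_on UNIV (\<lambda>y. F y z)"
    and f_diff: "\<forall>y. f differentiable (at y)"
    and f_C1: "continuous_on UNIV (grad f)"
    and L_pos: "0 < L"
    and f_Lipschitz: "L-lipschitz_on UNIV (grad f)"
    and optimal_nonempty: "{y. is_arg_min f (\<lambda>_. True) y} \<noteq> {}"
    \<comment> \<open>(A2)\<close>
    and samples_indep: "prob_space.indep_vars M (\<lambda>_. borel) xi UNIV"
    and samples_ident: "\<forall>k. distr M borel (xi k) = distr M borel \<xi>"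
    and unbiased_int: "\<forall>y. integrable M (\<lambda>w. grad (\<lambda>u. F u (\<xi> w)) y)"
    and unbiased: "\<forall>y. (\<integral>w. grad (\<lambda>u. F u (\<xi> w)) y \<partial>M) = grad f y"
    and \<nu>_pos: "0 < \<nu>"
    and variance: "\<forall>y. (\<integral>\<^sup>+w. ennreal ((norm (grad (\<lambda>u. F u (\<xi> w)) y - grad f y))\<^sup>2) \<partial>M)
                       \<le> ennreal (\<nu>\<^sup>2)"
    \<comment> \<open>the algorithm\<close>
    and x0_meas: "x 0 \<in> borel_measurable M"
    and x0_indep: "prob_space.indep_set M
                     (sets (vimage_algebra (space M) (x 0) borel))
                     (sets (vimage_algebra (space M) (\<lambda>w k. xi k w) (Pi\<^sub>M UNIV (\<lambda>_. borel))))"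
    and \<rho>: "0 < \<rho>" "\<rho> < 1"
    and \<gamma>_pos: "\<forall>k. 0 < \<gamma> k"
    and \<delta>_pos: "\<forall>k. 0 < \<delta> k"
    and \<mu>_pos: "\<forall>k. 0 < \<mu> k"
    and B0_sym: "transpose B0 = B0"
    and B0_lower: "psd (B0 - (\<rho> * \<mu> 0) *\<^sub>R mat 1)"
    and algorithm: "cr_sqn (space M) (\<lambda>y z. grad (\<lambda>u. F u z) y) xi \<gamma> \<delta> \<mu> \<rho> B0 x B"
    and nonzero: "\<forall>k. even k \<longrightarrow>
                    (AE w in M. grad (\<lambda>u. F u (xi k w)) (x k w) + \<mu> k *\<^sub>R x k w \<noteq> 0)"
    \<comment> \<open>(A4)\<close>
    and a: "(\<lambda>k. \<gamma> k / ((\<mu> k) ^ 3 * \<delta> k)) \<longlonglongrightarrow> 0"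
    and b: "\<forall>k\<ge>1. \<delta> k * \<mu> (k - 1) \<le> 1"
    and c: "\<forall>k. (even k \<longrightarrow> \<mu> (k + 1) = \<mu> k) \<and> (odd k \<longrightarrow> \<mu> (k + 1) < \<mu> k)"
    and \<alpha>: "0 < \<alpha>" "\<alpha> < 1"
    and d: "\<exists>K1. \<forall>k\<ge>K1. k \<ge> 1 \<longrightarrow>
              \<gamma> (k - 1) / ((\<mu> (k - 1)) ^ 3 * \<delta> (k - 1))
              \<le> \<gamma> k / ((\<mu> k) ^ 3 * \<delta> k) * (1 + \<alpha> * \<gamma> k * \<delta> k * \<mu> k)"
    and \<B>_pos: "0 < \<B>"
    and e: "\<exists>K2. \<forall>k\<ge>K2. \<delta> k * (\<mu> k) ^ 4 \<le> \<B> * \<gamma> k"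
  shows "\<forall>xstar. is_arg_min f (\<lambda>_. True) xstar \<longrightarrow>
    (let fstar = (INF y. f y) in
     \<exists>K. let eK1 = expect_ext M (\<lambda>w. regularized f (\<mu> (K + 1)) (x (K + 1) w)) - ereal fstar;
             \<theta> = max (ereal ((\<mu> K) ^ 3 * \<delta> K) * eK1 / ereal (\<gamma> K))
                     (ereal ((0.5 * \<B> * (norm xstar)\<^sup>2 + 2 * (L + \<mu> 0) * (\<nu>\<^sup>2 / \<rho>\<^sup>2)) / (1 - \<alpha>)))
         in \<forall>k\<ge>K. expect_ext M (\<lambda>w. f (x (k + 1) w)) - ereal fstar
                    \<le> \<theta> * ereal (\<gamma> k / ((\<mu> k) ^ 3 * \<delta> k)))"
proof (intro allI impI)
  fix xstar assume xstar: "is_arg_min f (\<lambda>_. True) xstar"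
  interpret prob_space M by (rule prob)
  define D where "D = grad f"
  have D: "GDERIV f y :> D y" for y
    unfolding D_def using f_diff by (simp add: GDERIV_grad)
  have lip: "L-lipschitz_on UNIV D" unfolding D_def by (rule f_Lipschitz)
  have conv: "convex_on UNIV f"
  proof (rule convex_onI)
    fix s :: real and u v :: "real^'n" assume s: "0 < s" "s < 1"
    have "f ((1 - s) *\<^sub>R u + s *\<^sub>R v) \<le> (\<integral>w. (1 - s) * F u (\<xi> w) + s * F v (\<xi> w) \<partial>M)"
      unfolding f_eq using F_int s F_convex realizations(1)
      by (intro integral_mono) (auto intro!: convex_onD)
    also have "\<dots> = (1 - s) * f u + s * f v" using F_int by (simp add: f_eq)
    finally show "f ((1 - s) *\<^sub>R u + s *\<^sub>R v) \<le> (1 - s) * f u + s * f v" .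
  qed simp
  have min: "f xstar \<le> f y" for y using xstar by (auto simp: is_arg_min_def not_less)
  have fstar: "(INF y. f y) = f xstar" by (rule cInf_eq_minimum) (auto simp: min)
  have [measurable]: "f \<in> borel_measurable borel"
    using f_diff by (intro borel_measurable_continuous_onI continuous_at_imp_continuous_on)
      (auto intro: differentiable_imp_continuous_within)
  have \<mu>_Suc: "\<mu> (Suc k) \<le> \<mu> k" for k using c[rule_format, of k] by (cases "even k") auto
  have \<mu>_le: "\<mu> k \<le> \<mu> 0" for k
    by (induction k) (auto intro: order_trans[OF \<mu>_Suc])
  define G where "G y z = grad (\<lambda>u. F u z) y" for y z
  \<comment> \<open>All realizations lie in \<open>\<Xi>\<close>, so \<open>g\<close> and
    \<open>G\<close> agree wherever the method evaluates the gradient.\<close>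
  obtain g where g: "(\<lambda>(y, z). g y z) \<in> borel_measurable (borel \<Otimes>\<^sub>M borel)"
    and gG: "\<And>y z. z \<in> \<Xi> \<Longrightarrow> g y z = G y z"
    unfolding G_def using ex_jointly_measurable_gradient[of F borel \<Xi>] F_meas F_diff by blast
  have alg: "cr_sqn (space M) G xi \<gamma> \<delta> \<mu> \<rho> B0 x B"
    using algorithm by (simp add: G_def[abs_def])
  have B_low: "\<rho> * \<mu> k * (norm v)\<^sup>2 \<le> inner v (B k w *v v)" if "w \<in> space M" for k w v
  proof -
    have "psd (B k w - (\<rho> * \<mu> k) *\<^sub>R mat 1)"
    proof (rule cr_sqn_matrix_lower_bound[OF alg that _ _ _ _ _ B0_lower])
      show "0 \<le> inner (G u (xi k w) - G v (xi k w)) (u - v)" for k u v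
        unfolding G_def using F_convex F_diff realizations(2) that
        by (intro convex_on_gradient_mono[of "\<lambda>y. F y (xi k w)"] GDERIV_grad) auto
    qed (use \<rho> \<mu>_pos \<mu>_Suc in \<open>auto intro: less_imp_le\<close>)
    then show ?thesis by (simp add: psd_diff_mat_iff)
  qed
  have hist: "x k \<in> borel_measurable (history M (x 0) xi k)" "B k \<in> borel_measurable (history M (x 0) xi k)" for k
    using cr_sqn_measurable_history[OF alg g, of k] gG realizations(2) by auto
  have X_hist: "(\<lambda>w. (x k w, B k w)) \<in> history M (x 0) xi k \<rightarrow>\<^sub>M borel \<Otimes>\<^sub>M borel" for k
    using hist[of k] by (intro measurable_Pair)
  note indep = history_indep[OF x0_meas samples_indep x0_indep X_hist]
  have meas[measurable]: "x k \<in> borel_measurable M" for k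
    using measurable_compose[OF indep(1)[of k] measurable_fst] by simp
  have [measurable]: "regularized f m \<in> borel_measurable borel" for m
    unfolding regularized_def[abs_def] by measurable
  have nonneg: "0 \<le> regularized f (\<mu> k) v - f xstar" for k v
    using min[of v] \<mu>_pos by (simp add: regularized_def add_increasing2 less_imp_le)

  \<comment> \<open>The gap is measured against f* for every k, not against the minimum of f_k, so
    consecutive gaps can be compared.\<close>
  define E where "E k = (\<integral>\<^sup>+w. ennreal (regularized f (\<mu> k) (x k w) - f xstar) \<partial>M)" for k
  define r where "r k = \<gamma> k / ((\<mu> k) ^ 3 * \<delta> k)" for k
  define t where "t k = \<gamma> k * \<delta> k * \<mu> k" for k
  \<comment> \<open>The numerator of the second entry of \<theta>, so that C / (1 - \<alpha>) \<le>
    \<theta> holds by the maximum.\<close>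
  define C where "C = 0.5 * \<B> * (norm xstar)\<^sup>2 + 2 * (L + \<mu> 0) * (\<nu>\<^sup>2 / \<rho>\<^sup>2)"
  have r_pos: "0 < r k" and t_pos: "0 < t k" for k
    using \<gamma>_pos \<delta>_pos \<mu>_pos by (auto simp: r_def t_def)
  have C_nonneg: "0 \<le> C" using \<B>_pos L_pos \<mu>_pos[rule_format, of 0] by (simp add: C_def)

  have step: "E (Suc k) \<le> ennreal (1 - t k) * E k + ennreal (C * t k * r k)"
    if k: "k \<ge> 1" "t k \<le> 1" "4 * (L + \<mu> 0) * \<mu> 0 * r k \<le> \<rho>\<^sup>2" "\<delta> k * (\<mu> k) ^ 4 \<le> \<B> * \<gamma> k" for k
  proof -
    \<comment> \<open>The inverse contributes 1 / (\<rho> \<mu>_k) to the norm bound. From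
      \<delta>_k \<mu>_k \<le> \<delta>_k \<mu>_{k-1} \<le> 1 and \<rho> < 1, the shift \<delta>_k
      contributes at most the same again.\<close>
    define \<Lambda> where "\<Lambda> = 2 / (\<rho> * \<mu> k)"
    have pos: "0 < \<gamma> k" "0 < \<delta> k" "0 < \<mu> k" using \<gamma>_pos \<delta>_pos \<mu>_pos by auto
    have \<gamma>r: "\<gamma> k = r k * (\<mu> k) ^ 3 * \<delta> k" using pos by (simp add: r_def)
    have "\<delta> k * \<mu> k \<le> \<delta> k * \<mu> (k - 1)"
      using pos \<mu>_Suc[of "k - 1"] k(1) by (intro mult_left_mono) auto
    then have "\<delta> k * \<mu> k \<le> 1" using b k(1) by (meson order_trans)
    then have "\<delta> k \<le> 1 / (\<rho> * \<mu> k)"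
      using pos \<rho> by (simp add: field_simps) (smt (verit) mult_left_le_one_le mult_pos_pos mult.assoc)
    then have \<Lambda>: "1 / (\<rho> * \<mu> k) + \<delta> k \<le> \<Lambda>" by (simp add: \<Lambda>_def)
    \<comment> \<open>Substituting \<gamma>_k = r_k \<mu>_k^3 \<delta>_k cancels the \<mu>_k^2 in
      the denominator of \<Lambda>^2, leaving 4 (L + \<mu>_k) \<mu>_k r_k \<delta>_k /
      \<rho>^2.\<close>
    have \<gamma>\<Lambda>: "(L + \<mu> k) * \<gamma> k * \<Lambda>\<^sup>2 \<le> \<delta> k"
    proof -
      have "(L + \<mu> k) * \<gamma> k * \<Lambda>\<^sup>2 = 4 * (L + \<mu> k) * \<mu> k * r k * (\<delta> k / \<rho>\<^sup>2)"
        unfolding \<Lambda>_def \<gamma>r using pos \<rho> by (simp add: field_simps power2_eq_square power3_eq_cube)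
      also have "\<dots> \<le> 4 * (L + \<mu> 0) * \<mu> 0 * r k * (\<delta> k / \<rho>\<^sup>2)"
        using \<mu>_le[of k] pos L_pos r_pos[of k]
        by (intro mult_right_mono mult_mono) auto
      also have "\<dots> \<le> \<rho>\<^sup>2 * (\<delta> k / \<rho>\<^sup>2)"
        using k(3) pos by (intro mult_right_mono) auto
      finally show ?thesis using \<rho> by simp
    qed
    define rest where "rest = \<gamma> k * \<delta> k * (\<mu> k)\<^sup>2 / 2 * (norm xstar)\<^sup>2
      + (L + \<mu> k) / 2 * (\<gamma> k)\<^sup>2 * \<Lambda>\<^sup>2 * \<nu>\<^sup>2"
    have rest_nonneg: "0 \<le> rest" using pos L_pos by (simp add: rest_def)
    have rest_le: "rest \<le> C * t k * r k"
    proof -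
      \<comment> \<open>Both error terms scale like \<gamma>_k^2 / \<mu>_k^2: the first by condition
        (e), the second because \<Lambda>^2 = 4 / (\<rho>^2 \<mu>_k^2).\<close>
      have tr: "t k * r k = (\<gamma> k)\<^sup>2 / (\<mu> k)\<^sup>2"
        using pos by (simp add: t_def r_def field_simps power2_eq_square power3_eq_cube)
      have "\<gamma> k * \<delta> k * (\<mu> k)\<^sup>2 = \<gamma> k / (\<mu> k)\<^sup>2 * (\<delta> k * (\<mu> k) ^ 4)"
        using pos by (simp add: field_simps power2_eq_square power4_eq_xxxx)
      also have "\<dots> \<le> \<gamma> k / (\<mu> k)\<^sup>2 * (\<B> * \<gamma> k)"
        using k(4) pos by (intro mult_left_mono) auto
      also have "\<dots> = \<B> * (t k * r k)" unfolding tr by (simp add: power2_eq_square)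
      finally have "\<gamma> k * \<delta> k * (\<mu> k)\<^sup>2 * ((norm xstar)\<^sup>2 / 2) \<le> \<B> * (t k * r k) * ((norm xstar)\<^sup>2 / 2)"
        by (rule mult_right_mono) simp
      then have "\<gamma> k * \<delta> k * (\<mu> k)\<^sup>2 / 2 * (norm xstar)\<^sup>2 \<le> \<B> * (t k * r k) * ((norm xstar)\<^sup>2 / 2)"
        by simp
      moreover have "(L + \<mu> k) / 2 * (\<gamma> k)\<^sup>2 * \<Lambda>\<^sup>2 * \<nu>\<^sup>2 = (L + \<mu> k) * (2 * (\<nu>\<^sup>2 / \<rho>\<^sup>2) * (t k * r k))"
        unfolding tr \<Lambda>_def using pos \<rho> by (simp add: field_simps power2_eq_square)
      then have "(L + \<mu> k) / 2 * (\<gamma> k)\<^sup>2 * \<Lambda>\<^sup>2 * \<nu>\<^sup>2 \<le> (L + \<mu> 0) * (2 * (\<nu>\<^sup>2 / \<rho>\<^sup>2) * (t k * r k))"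
        using \<mu>_le[of k] r_pos[of k] t_pos[of k] by (simp only:) (intro mult_right_mono, auto)
      ultimately have "rest \<le> \<B> * (t k * r k) * ((norm xstar)\<^sup>2 / 2)
          + (L + \<mu> 0) * (2 * (\<nu>\<^sup>2 / \<rho>\<^sup>2) * (t k * r k))"
        unfolding rest_def by (rule add_mono)
      also have "\<dots> = C * t k * r k" by (simp add: C_def algebra_simps add_divide_distrib)
      finally show ?thesis .
    qed
    define \<phi> where "\<phi> p z = ennreal (regularized f (\<mu> k) (fst p - \<gamma> k *\<^sub>R
        ((matrix_inv (snd p) + \<delta> k *\<^sub>R mat 1) *v (g (fst p) z + \<mu> k *\<^sub>R fst p))) - f xstar)"
      for p :: "(real^'n) \<times> (real^'n^'n)" and z
    have [measurable]: "(\<lambda>q. g (fst (fst q)) (snd q))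
        \<in> borel_measurable ((borel \<Otimes>\<^sub>M (borel :: (real^'n^'n) measure)) \<Otimes>\<^sub>M borel)"
      using measurable_compose[OF _ g, of "\<lambda>q. (fst (fst q), snd q)"
          "(borel \<Otimes>\<^sub>M (borel :: (real^'n^'n) measure)) \<Otimes>\<^sub>M borel"] by simp
    have \<phi>_meas: "(\<lambda>(p, z). \<phi> p z) \<in> borel_measurable ((borel \<Otimes>\<^sub>M borel) \<Otimes>\<^sub>M borel)"
      unfolding \<phi>_def split_beta by measurable
    have xi_k: "xi k \<in> borel_measurable M" using samples_indep by (simp add: indep_vars_def)
    have "E (Suc k) \<le> (\<integral>\<^sup>+w. \<phi> (x k w, B k w) (xi k w) \<partial>M)"
      unfolding E_def
    proof (rule nn_integral_mono)
      fix w assume w: "w \<in> space M"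
      have "x (Suc k) w = x k w - \<gamma> k *\<^sub>R
          ((matrix_inv (B k w) + \<delta> k *\<^sub>R mat 1) *v (g (x k w) (xi k w) + \<mu> k *\<^sub>R x k w))"
        using alg w gG realizations(2) by (simp add: cr_sqn_def)
      \<comment> \<open>Replacing \<mu>_{k+1} by \<mu>_k can only raise the objective, so the step
        is analysed with one fixed regularization.\<close>
      moreover have "regularized f (\<mu> (Suc k)) v \<le> regularized f (\<mu> k) v" for v
        using \<mu>_Suc[of k] by (simp add: regularized_def mult_right_mono)
      ultimately show "ennreal (regularized f (\<mu> (Suc k)) (x (Suc k) w) - f xstar) \<le> \<phi> (x k w, B k w) (xi k w)"
        by (auto simp: \<phi>_def intro!: ennreal_leI)
    qed
    also have "\<dots> = (\<integral>\<^sup>+w. (\<integral>\<^sup>+w'. \<phi> (x k w, B k w) (\<xi> w') \<partial>M) \<partial>M)"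
      using samples_ident xi_k by (intro nn_integral_joint_distr[OF indep(1) _ indep(2) _ xi_meas \<phi>_meas]) auto
    also have "\<dots> \<le> (\<integral>\<^sup>+w. ennreal (1 - t k) * ennreal (regularized f (\<mu> k) (x k w) - f xstar) + ennreal rest \<partial>M)"
    proof (rule nn_integral_mono)
      fix w assume w: "w \<in> space M"
      let ?u = "x k w" and ?H = "matrix_inv (B k w) + \<delta> k *\<^sub>R mat 1"
      have c: "0 < \<rho> * \<mu> k" using \<rho> pos by simp
      have H: "norm (?H *v v) \<le> \<Lambda> * norm v" for v
        using shifted_inv_bounded[OF c B_low[OF w], of "\<delta> k" v] pos mult_right_mono[OF \<Lambda>, of "norm v"]
        by simp
      have "(\<integral>\<^sup>+w'. \<phi> (?u, B k w) (\<xi> w') \<partial>M)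
          = (\<integral>\<^sup>+w'. ennreal (regularized f (\<mu> k) (?u - \<gamma> k *\<^sub>R (?H *v (G ?u (\<xi> w') + \<mu> k *\<^sub>R ?u))) - f xstar) \<partial>M)"
        using gG realizations(1) by (intro nn_integral_cong) (simp add: \<phi>_def)
      also have "\<dots> \<le> ennreal ((1 - t k) * (regularized f (\<mu> k) ?u - f xstar)
          + \<gamma> k * \<delta> k * (\<mu> k)\<^sup>2 / 2 * (norm xstar)\<^sup>2 + (L + \<mu> k) / 2 * (\<gamma> k)\<^sup>2 * \<Lambda>\<^sup>2 * \<nu>\<^sup>2)"
        unfolding t_def
      proof (rule regularized_expected_decrease[OF D lip conv min])
        show "\<delta> k * (norm v)\<^sup>2 \<le> inner v (?H *v v)" for v
          using shifted_inv_coercive[OF c B_low[OF w], of "\<delta> k" v] pos by simp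
        show "integrable M (\<lambda>w'. G ?u (\<xi> w'))" "(\<integral>w'. G ?u (\<xi> w') \<partial>M) = D ?u"
          "(\<integral>\<^sup>+w'. ennreal ((norm (G ?u (\<xi> w') - D ?u))\<^sup>2) \<partial>M) \<le> ennreal (\<nu>\<^sup>2)"
          unfolding G_def D_def using unbiased_int unbiased variance by auto
      qed (use pos L_pos \<gamma>\<Lambda> H in auto)
      also have "\<dots> = ennreal ((1 - t k) * (regularized f (\<mu> k) ?u - f xstar) + rest)"
        by (simp add: rest_def add.assoc)
      also have "\<dots> = ennreal (1 - t k) * ennreal (regularized f (\<mu> k) ?u - f xstar) + ennreal rest"
        using k(2) rest_nonneg nonneg by (simp add: ennreal_mult ennreal_plus)
      finally show "(\<integral>\<^sup>+w'. \<phi> (?u, B k w) (\<xi> w') \<partial>M)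
          \<le> ennreal (1 - t k) * ennreal (regularized f (\<mu> k) ?u - f xstar) + ennreal rest" .
    qed
    also have "\<dots> = ennreal (1 - t k) * E k + ennreal rest"
      unfolding E_def by (subst nn_integral_add) (auto simp: nn_integral_cmult emeasure_space_1)
    also have "\<dots> \<le> ennreal (1 - t k) * E k + ennreal (C * t k * r k)"
      using rest_le by (intro add_left_mono ennreal_leI)
    finally show ?thesis .
  qed

  have ev: "\<exists>K\<ge>1. \<forall>k\<ge>K. t k \<le> 1 \<and> 4 * (L + \<mu> 0) * \<mu> 0 * r k \<le> \<rho>\<^sup>2
      \<and> \<delta> k * (\<mu> k) ^ 4 \<le> \<B> * \<gamma> k \<and> r k \<le> r (Suc k) * (1 + \<alpha> * t (Suc k))"
  proof -
    have r0: "r \<longlonglongrightarrow> 0" using a by (simp add: r_def[abs_def])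
    have "(\<lambda>k. 4 * (L + \<mu> 0) * \<mu> 0 * r k) \<longlonglongrightarrow> 4 * (L + \<mu> 0) * \<mu> 0 * 0"
      by (intro tendsto_intros r0)
    then have "\<forall>\<^sub>F k in sequentially. 4 * (L + \<mu> 0) * \<mu> 0 * r k < \<rho>\<^sup>2"
      using \<rho> by (intro order_tendstoD(2)) auto
    moreover have "(\<lambda>k. (\<mu> 0)\<^sup>2 * r k) \<longlonglongrightarrow> (\<mu> 0)\<^sup>2 * 0"
      by (intro tendsto_intros r0)
    then have "\<forall>\<^sub>F k in sequentially. (\<mu> 0)\<^sup>2 * r k < 1"
      by (intro order_tendstoD(2)) auto
    ultimately obtain K0 where K0: "\<And>k. k \<ge> K0 \<Longrightarrow> 4 * (L + \<mu> 0) * \<mu> 0 * r k < \<rho>\<^sup>2 \<and> (\<mu> 0)\<^sup>2 * r k < 1"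
      using eventually_conj unfolding eventually_sequentially by (metis (no_types, lifting) le_cases order_trans)
    obtain K1 where K1: "\<And>k. k \<ge> K1 \<Longrightarrow> k \<ge> 1 \<Longrightarrow> r (k - 1) \<le> r k * (1 + \<alpha> * t k)"
      using d unfolding r_def t_def by (auto simp: mult.assoc)
    obtain K2 where K2: "\<And>k. k \<ge> K2 \<Longrightarrow> \<delta> k * (\<mu> k) ^ 4 \<le> \<B> * \<gamma> k" using e by blast
    \<comment> \<open>Through the identity t_k = (\<delta>_k \<mu>_k)^2 \<mu>_k^2 r_k, conditions
      (a) and (b) force t_k to 0, which makes t_k \<le> 1 eventually.\<close>
    have t_le: "t k \<le> (\<mu> 0)\<^sup>2 * r k" if "k \<ge> 1" for k
    proof -
      have pos: "0 < \<gamma> k" "0 < \<delta> k" "0 < \<mu> k" using \<gamma>_pos \<delta>_pos \<mu>_pos by auto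
      have "\<delta> k * \<mu> k \<le> \<delta> k * \<mu> (k - 1)"
        using pos \<mu>_Suc[of "k - 1"] that by (intro mult_left_mono) auto
      then have "\<delta> k * \<mu> k \<le> 1" using b that by (meson order_trans)
      then have "(\<delta> k * \<mu> k)\<^sup>2 \<le> 1" using pos by (simp add: power_le_one)
      moreover have "(\<mu> k)\<^sup>2 \<le> (\<mu> 0)\<^sup>2" using \<mu>_le[of k] pos by (intro power_mono) auto
      ultimately have "(\<delta> k * \<mu> k)\<^sup>2 * (\<mu> k)\<^sup>2 \<le> 1 * (\<mu> 0)\<^sup>2" by (intro mult_mono) auto
      then have "(\<delta> k * \<mu> k)\<^sup>2 * (\<mu> k)\<^sup>2 * r k \<le> 1 * (\<mu> 0)\<^sup>2 * r k"
        using r_pos[of k] by (intro mult_right_mono) auto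
      moreover have "t k = (\<delta> k * \<mu> k)\<^sup>2 * (\<mu> k)\<^sup>2 * r k"
        using pos by (simp add: t_def r_def field_simps power2_eq_square power3_eq_cube)
      ultimately show ?thesis by simp
    qed
    show ?thesis
    proof (intro exI[of _ "max 1 (max K0 (max K1 K2))"] conjI allI impI)
      fix k assume k: "k \<ge> max 1 (max K0 (max K1 K2))"
      then show "t k \<le> 1" using t_le[of k] K0[of k] by simp
      show "4 * (L + \<mu> 0) * \<mu> 0 * r k \<le> \<rho>\<^sup>2" using K0[of k] k by simp
      show "\<delta> k * (\<mu> k) ^ 4 \<le> \<B> * \<gamma> k" using K2[of k] k by simp
      show "r k \<le> r (Suc k) * (1 + \<alpha> * t (Suc k))" using K1[of "Suc k"] k by simp
    qed simp
  qed
  then obtain K where K: "K \<ge> 1" "\<And>k. k \<ge> K \<Longrightarrow> t k \<le> 1"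
    "\<And>k. k \<ge> K \<Longrightarrow> 4 * (L + \<mu> 0) * \<mu> 0 * r k \<le> \<rho>\<^sup>2"
    "\<And>k. k \<ge> K \<Longrightarrow> \<delta> k * (\<mu> k) ^ 4 \<le> \<B> * \<gamma> k"
    "\<And>k. k \<ge> K \<Longrightarrow> r k \<le> r (Suc k) * (1 + \<alpha> * t (Suc k))"
    by blast

  have E_ext: "expect_ext M (\<lambda>w. regularized f (\<mu> k) (x k w)) - ereal (f xstar) = enn2ereal (E k)" for k
    unfolding E_def using nonneg by (intro expect_ext_diff_lower_bound) auto
  have f_ext: "expect_ext M (\<lambda>w. f (x k w)) - ereal (f xstar) \<le> enn2ereal (E k)" for k
  proof -
    have "expect_ext M (\<lambda>w. f (x k w)) - ereal (f xstar) = enn2ereal (\<integral>\<^sup>+w. ennreal (f (x k w) - f xstar) \<partial>M)"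
      using min by (intro expect_ext_diff_lower_bound) auto
    also have "\<dots> \<le> enn2ereal (E k)"
      unfolding E_def using \<mu>_pos
      by (intro less_eq_ennreal.rep_eq[THEN iffD1] nn_integral_mono ennreal_leI) (simp add: regularized_def less_imp_le)
    finally show ?thesis .
  qed
  define \<theta> where "\<theta> = max (ereal ((\<mu> K) ^ 3 * \<delta> K) * enn2ereal (E (Suc K)) / ereal (\<gamma> K)) (ereal (C / (1 - \<alpha>)))"
  have bound: "enn2ereal (E (Suc k)) \<le> \<theta> * ereal (r k)" if k: "k \<ge> K" for k
  proof (cases "E (Suc K)")
    case (real e0)
    define \<theta>' where "\<theta>' = max ((\<mu> K) ^ 3 * \<delta> K * e0 / \<gamma> K) (C / (1 - \<alpha>))"
    have \<theta>': "\<theta> = ereal \<theta>'"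
      using real \<gamma>_pos[rule_format, of K] by (simp add: \<theta>_def \<theta>'_def enn2ereal_ennreal max_def)
    have "E (Suc k) \<le> ennreal (\<theta>' * r k)"
    proof (rule contraction_rate[where K = K and t = t and C = C and \<alpha> = \<alpha>])
      \<comment> \<open>The first entry of the maximum is e_{K+1} / r_K, chosen to make the base
        case hold.\<close>
      have "(\<mu> K) ^ 3 * \<delta> K * e0 / \<gamma> K * r K \<le> \<theta>' * r K"
        using r_pos[of K] by (intro mult_right_mono) (auto simp: \<theta>'_def)
      moreover have "(\<mu> K) ^ 3 * \<delta> K * e0 / \<gamma> K * r K = e0"
        using \<gamma>_pos[rule_format, of K] \<delta>_pos[rule_format, of K] \<mu>_pos[rule_format, of K] by (simp add: r_def)
      ultimately show "E (Suc K) \<le> ennreal (\<theta>' * r K)" using real by (simp add: ennreal_leI)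
    qed (use r_pos t_pos K \<alpha> C_nonneg step k in \<open>auto simp: \<theta>'_def less_imp_le\<close>)
    moreover have "0 \<le> \<theta>'" using C_nonneg \<alpha> by (simp add: \<theta>'_def le_max_iff_disj)
    ultimately show ?thesis
      using r_pos[of k] less_eq_ennreal.rep_eq[of "E (Suc k)" "ennreal (\<theta>' * r k)"]
      by (simp add: \<theta>' enn2ereal_ennreal less_imp_le)
  next
    \<comment> \<open>An infinite e_{K+1} makes \<theta> infinite; as r_k > 0, the bound is then
      trivial.\<close>
    case top
    have "\<theta> = \<infinity>"
      using top \<gamma>_pos[rule_format, of K] \<delta>_pos[rule_format, of K] \<mu>_pos[rule_format, of K]
      by (simp add: \<theta>_def max_def)
    then show ?thesis using r_pos[of k] by simp
  qed
  show "let fstar = (INF y. f y) in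
     \<exists>K. let eK1 = expect_ext M (\<lambda>w. regularized f (\<mu> (K + 1)) (x (K + 1) w)) - ereal fstar;
             \<theta> = max (ereal ((\<mu> K) ^ 3 * \<delta> K) * eK1 / ereal (\<gamma> K))
                     (ereal ((0.5 * \<B> * (norm xstar)\<^sup>2 + 2 * (L + \<mu> 0) * (\<nu>\<^sup>2 / \<rho>\<^sup>2)) / (1 - \<alpha>)))
         in \<forall>k\<ge>K. expect_ext M (\<lambda>w. f (x (k + 1) w)) - ereal fstar
                    \<le> \<theta> * ereal (\<gamma> k / ((\<mu> k) ^ 3 * \<delta> k))"
    unfolding Let_def fstar E_ext
    using order_trans[OF f_ext bound]
    by (intro exI[of _ K]) (auto simp: \<theta>_def C_def r_def)
qed

end
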